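(* Let $n\ge 1$ and $\Sigma\in\mathrm{Sym}^+(n)$, where $\mathrm{Sym}^+(n)$ is endowed with the Bures-Wasserstein Riemannian metric. 1. (Exponential map) For all $V\in T_\Sigma\mathrm{Sym}^+(n)\equiv\mathrm{Sym}(n)$, the geodesic from $\Sigma$ with initial speed $V$ is $$\gamma_{(\Sigma,V)}(t)=\Sigma+tV+t^2\,\mathcal{S}_\Sigma(V)\,\Sigma\,\mathcal{S}_\Sigma(V)\in\mathrm{Sym}^+(n),\qquad t\in I_{\Sigma,V}.$$ 2. (Definition interval) For $V\in\mathrm{Sym}(n)$, let $\lambda_{\max}$ and $\lambda_{\min}$ be the largest and smallest eigenvalues of $\mathcal{S}_\Sigma(V)$. The definition interval $I_{\Sigma,V}$ of $\gamma_{(\Sigma,V)}$ is: - $I_{\Sigma,V}=(-\frac{1}{\lambda_{\max}},-\frac{1}{\lambda_{\min}})$ if $\lambda_{\min}<0<\lambda_{\max}$; - $I_{\Sigma,V}=(-\infty,-\frac{1}{\lambda_{\min}})$ if $\lambda_{\min}<0$ and $\lambda_{\max}\le 0$; - $I_{\Sigma,V}=(-\frac{1}{\lambda_{\max}},+\infty)$ if $\lambda_{\min}\ge 0$ and $\lambda_{\max}>0$; - $I_{\Sigma,V}=\mathbb{R}$ if $\lambda_{\min}=\lambda_{\max}=0$ (which only happens for $V=0$). 3. (Cut time) The cut time is $t_{cut}(\Sigma,V)=-\frac{1}{\lambda_{\min}}$ if $\lambda_{\min}<0$ and $t_{cut}(\Sigma,V)=+\infty$ otherwise. Moreover, the geodesic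 $\gamma_{(\Sigma,V)}:I_{\Sigma,V}\to\mathrm{Sym}^+(n)$ is (globally) minimizing on the whole of $I_{\Sigma,V}$. 4. (Logarithm map) For all $\Lambda\in\mathrm{Sym}^+(n)$, there exists a unique preimage $V\in\mathcal{P}re_\Sigma(\Lambda)$, and it is $$V=2\,\mathrm{sym}\big(\Sigma^{1/2}(\Sigma^{1/2}\Lambda\Sigma^{1/2})^{1/2}\Sigma^{-1/2}\big)-2\Sigma.$$ The geodesic joining $\Sigma$ to $\Lambda$ is $$\gamma_{\Sigma\to\Lambda}(t)=(1-t)^2\Sigma+t^2\Lambda+2t(1-t)\,\mathrm{sym}\big(\Sigma^{1/2}(\Sigma^{1/2}\Lambda\Sigma^{1/2})^{1/2}\Sigma^{-1/2}\big).$$ Moreover, $V$ is a logarithm: $V\in\mathcal{L}og_\Sigma(\Lambda)$. Thus the logarithm map is defined on $\mathcal{U}_\Sigma=\mathrm{Sym}^+(n)$ and it is $$\mathrm{Log}_\Sigma:\mathrm{Sym}^+(n)\to T_\Sigma\mathrm{Sym}^+(n),\qquad \Lambda\mapsto 2\,\mathrm{sym}\big(\Sigma^{1/2}(\Sigma^{1/2}\Lambda\Sigma^{1/2})^{1/2}\Sigma^{-1/2}\big)-2\Sigma.$$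
   Context: $\mathrm{Sym}(n)$ is the space of real symmetric $n\times n$ matrices; $\mathrm{Sym}^+(n)\subset\mathrm{Sym}(n)$ is the open set (hence manifold) of symmetric positive definite matrices, with $T_\Sigma\mathrm{Sym}^+(n)\equiv\mathrm{Sym}(n)$. $\mathrm{sym}(M)=\frac12(M+M^\top)$. For a symmetric positive semi-definite matrix $A$, $A^{1/2}$ is its unique symmetric positive semi-definite square root. For $\Sigma\in\mathrm{Sym}^+(n)$ and $V\in\mathrm{Sym}(n)$, $\mathcal{S}_\Sigma(V)\in\mathrm{Sym}(n)$ is the unique solution $Z$ of $\Sigma Z+Z\Sigma=V$. The Bures-Wasserstein metric on $\mathrm{Sym}^+(n)$ is the Riemannian metric $g_\Sigma(V,V)=\mathrm{tr}(\mathcal{S}_\Sigma(V)\Sigma\mathcal{S}_\Sigma(V))$; it is the quotient metric that makes $X\in\mathrm{GL}(n)\mapsto XX^\top\in\mathrm{Sym}^+(n)$ a Riemannian submersion from $\mathrm{GL}(n)$ with the Frobenius metric $\langle M,M\rangle=\mathrm{tr}(M^\top M)$. Let $d$ be its Riemannian distance and $\|V\|=\sqrt{g_\Sigma(V,V)}$. Geodesics are those of the Levi-Civita connection: $\gamma_{(\Sigma,V)}:I_{\Sigma,V}\to\mathrm{Sym}^+(n)$ is the maximal geodesic with $\gamma(0)=\Sigma$, $\dot\gamma(0)=V$, and $I_{\Sigma,V}$, its maximal interval of definition, is called the definition interval. The exponential map is $\mathrm{Exp}_\Sigma(V)=\gamma_{(\Sigma,V)}(1)$, defined when $1\in I_{\Sigma,V}$.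 A curve $c:I\to\mathrm{Sym}^+(n)$ is (globally) minimizing if for all $a\le b$ in $I$ the length of $c|_{[a,b]}$ equals $d(c(a),c(b))$. The cut time is $t_{cut}(\Sigma,V)=\sup\{t\in I_{\Sigma,V}: d(\Sigma,\mathrm{Exp}_\Sigma(tV))=t\|V\|\}$. The set of preimages is $\mathcal{P}re_\Sigma(\Lambda)=\{V\in T_\Sigma\mathrm{Sym}^+(n): 1\in I_{\Sigma,V}\text{ and }\mathrm{Exp}_\Sigma(V)=\Lambda\}$; the set of (Riemannian) logarithms is $\mathcal{L}og_\Sigma(\Lambda)=\{V\in\mathcal{P}re_\Sigma(\Lambda):\|V\|=d(\Sigma,\Lambda)\}$; $\mathcal{U}_\Sigma$ is the set of $\Lambda$ having exactly one logarithm from $\Sigma$, and $\mathrm{Log}_\Sigma:\mathcal{U}_\Sigma\to T_\Sigma\mathrm{Sym}^+(n)$ maps $\Lambda$ to this logarithm. The geodesic joining $\Sigma$ to $\Lambda$ is $\gamma_{\Sigma\to\Lambda}=\gamma_{(\Sigma,V)}$ for the unique $V\in\mathcal{P}re_\Sigma(\Lambda)$. *)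

theory Defs
  imports "HOL-Analysis.Analysis"
begin

section \<open>Riemannian metrics on a relatively open subset of a linear subspace\<close>

definition dirderiv ::
    "('a::real_normed_vector \<Rightarrow> 'b::real_normed_vector) \<Rightarrow> 'a \<Rightarrow> 'a \<Rightarrow> 'b" where
  "dirderiv f p v = vector_derivative (\<lambda>t. f (p + t *\<^sub>R v)) (at 0)"

text \<open>
  Piecewise continuously differentiable on the closed interval from a to b, with one-sided
  derivatives at the break points \<open>S\<close>. The library's \<open>valid_path\<close> puts no condition on the
  derivative near the break points, so it admits curves of infinite length.
\<close>
definition piecewise_C1_curve :: "real \<Rightarrow> real \<Rightarrow> (real \<Rightarrow> 'a::real_normed_vector) \<Rightarrow> bool" where
  "piecewise_C1_curve a b c \<longleftrightarrow>
     (\<exists>S. finite S \<and>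
        (\<forall>x y. a \<le> x \<and> x < y \<and> y \<le> b \<and> {x<..<y} \<inter> S = {} \<longrightarrow>
           (\<exists>D. continuous_on {x..y} D \<and>
                (\<forall>t\<in>{x..y}. (c has_vector_derivative D t) (at t within {x..y})))))"

text \<open>
  The manifold is \<open>U\<close>, a relatively open subset of the linear subspace \<open>E\<close>; its tangent space
  at every point is \<open>E\<close>, and \<open>g p u v\<close> is the inner product of the tangent vectors \<open>u\<close>, \<open>v\<close> at
  \<open>p\<close>. Values outside \<open>U\<close> and \<open>E\<close> are irrelevant. The locale only fixes notation; that \<open>U\<close>, \<open>E\<close>
  and \<open>g\<close> do form a Riemannian manifold is a property of the instance used.
\<close>
locale riem =
  fixes E U :: "'a::euclidean_space set"
    and g :: "'a \<Rightarrow> 'a \<Rightarrow> 'a \<Rightarrow> real"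
begin

definition vnorm :: "'a \<Rightarrow> 'a \<Rightarrow> real" where
  "vnorm p v = sqrt (g p v v)"

definition curve_length :: "(real \<Rightarrow> 'a) \<Rightarrow> real \<Rightarrow> real \<Rightarrow> real" where
  "curve_length c a b = integral {a..b} (\<lambda>t. vnorm (c t) (vector_derivative c (at t)))"

definition rdist :: "'a \<Rightarrow> 'a \<Rightarrow> real" where
  "rdist p q = Inf {curve_length c 0 1 | c.
     piecewise_C1_curve 0 1 c \<and> c ` {0..1} \<subseteq> U \<and> c 0 = p \<and> c 1 = q}"

text \<open>
  In the global chart given by \<open>U\<close> itself, an affine connection is the flat derivative plus a field
  \<open>\<Gamma>\<close> of bilinear maps (its Christoffel symbols).
\<close>
definition vector_fields :: "('a \<Rightarrow> 'a) set" where
  "vector_fields = {X. (\<forall>p\<in>U. X p \<in> E) \<and> X differentiable_on U}"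

definition christoffel :: "('a \<Rightarrow> 'a \<Rightarrow> 'a \<Rightarrow> 'a) \<Rightarrow> bool" where
  "christoffel \<Gamma> \<longleftrightarrow>
     (\<forall>p\<in>U. \<forall>u\<in>E. \<forall>v\<in>E. \<Gamma> p u v \<in> E) \<and>
     (\<forall>p\<in>U. \<forall>u\<in>E. \<forall>v\<in>E. \<forall>w\<in>E. \<forall>a b.
        \<Gamma> p (a *\<^sub>R u + b *\<^sub>R v) w = a *\<^sub>R \<Gamma> p u w + b *\<^sub>R \<Gamma> p v w \<and>
        \<Gamma> p w (a *\<^sub>R u + b *\<^sub>R v) = a *\<^sub>R \<Gamma> p w u + b *\<^sub>R \<Gamma> p w v)"

definition nabla ::
    "('a \<Rightarrow> 'a \<Rightarrow> 'a \<Rightarrow> 'a) \<Rightarrow> ('a \<Rightarrow> 'a) \<Rightarrow> ('a \<Rightarrow> 'a) \<Rightarrow> 'a \<Rightarrow> 'a" where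
  "nabla \<Gamma> X Y p = dirderiv Y p (X p) + \<Gamma> p (X p) (Y p)"

definition lie_bracket :: "('a \<Rightarrow> 'a) \<Rightarrow> ('a \<Rightarrow> 'a) \<Rightarrow> 'a \<Rightarrow> 'a" where
  "lie_bracket X Y p = dirderiv Y p (X p) - dirderiv X p (Y p)"

definition torsion_free :: "('a \<Rightarrow> 'a \<Rightarrow> 'a \<Rightarrow> 'a) \<Rightarrow> bool" where
  "torsion_free \<Gamma> \<longleftrightarrow>
     (\<forall>X\<in>vector_fields. \<forall>Y\<in>vector_fields. \<forall>p\<in>U.
        nabla \<Gamma> X Y p - nabla \<Gamma> Y X p = lie_bracket X Y p)"

definition metric_compatible :: "('a \<Rightarrow> 'a \<Rightarrow> 'a \<Rightarrow> 'a) \<Rightarrow> bool" where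
  "metric_compatible \<Gamma> \<longleftrightarrow>
     (\<forall>X\<in>vector_fields. \<forall>Y\<in>vector_fields. \<forall>Z\<in>vector_fields. \<forall>p\<in>U.
        dirderiv (\<lambda>q. g q (Y q) (Z q)) p (X p) =
          g p (nabla \<Gamma> X Y p) (Z p) + g p (Y p) (nabla \<Gamma> X Z p))"

text \<open>
  Both conditions are tensorial, so it does not matter that the fields are only required to be
  differentiable. They determine \<open>\<Gamma>\<close> on \<open>U\<close> and \<open>E\<close> (and make it smooth when \<open>g\<close> is), so
  the choice below only affects irrelevant values.
\<close>
definition levi_civita :: "'a \<Rightarrow> 'a \<Rightarrow> 'a \<Rightarrow> 'a" where
  "levi_civita = (SOME \<Gamma>. christoffel \<Gamma> \<and> torsion_free \<Gamma> \<and> metric_compatible \<Gamma>)"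

text \<open>The last equation says that the covariant derivative of the velocity along \<open>c\<close> vanishes.\<close>
definition geodesic :: "real set \<Rightarrow> (real \<Rightarrow> 'a) \<Rightarrow> bool" where
  "geodesic I c \<longleftrightarrow> open I \<and> is_interval I \<and> c ` I \<subseteq> U \<and>
     (\<exists>c' c''. \<forall>t\<in>I.
        (c has_vector_derivative c' t) (at t) \<and>
        (c' has_vector_derivative c'' t) (at t) \<and>
        c'' t + levi_civita (c t) (c' t) (c' t) = 0)"

definition geodesic_from :: "'a \<Rightarrow> 'a \<Rightarrow> real set \<Rightarrow> (real \<Rightarrow> 'a) \<Rightarrow> bool" where
  "geodesic_from p v I c \<longleftrightarrow>
     geodesic I c \<and> 0 \<in> I \<and> c 0 = p \<and> (c has_vector_derivative v) (at 0)"

definition maximal_geodesic :: "'a \<Rightarrow> 'a \<Rightarrow> real set \<Rightarrow> (real \<Rightarrow> 'a) \<Rightarrow> bool" where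
  "maximal_geodesic p v I c \<longleftrightarrow>
     geodesic_from p v I c \<and>
     (\<forall>J b. geodesic_from p v J b \<longrightarrow> J \<subseteq> I \<and> (\<forall>t\<in>J. b t = c t))"

definition def_interval :: "'a \<Rightarrow> 'a \<Rightarrow> real set" where
  "def_interval p v = (THE I. \<exists>c. maximal_geodesic p v I c)"

text \<open>Only the values of \<open>geod p v\<close> on \<open>def_interval p v\<close> are meaningful.\<close>
definition geod :: "'a \<Rightarrow> 'a \<Rightarrow> real \<Rightarrow> 'a" where
  "geod p v = (SOME c. maximal_geodesic p v (def_interval p v) c)"

definition Exp :: "'a \<Rightarrow> 'a \<Rightarrow> 'a" where
  "Exp p v = geod p v 1"

definition minimizing :: "real set \<Rightarrow> (real \<Rightarrow> 'a) \<Rightarrow> bool" where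
  "minimizing I c \<longleftrightarrow>
     (\<forall>a\<in>I. \<forall>b\<in>I. a \<le> b \<longrightarrow> curve_length c a b = rdist (c a) (c b))"

definition cut_time :: "'a \<Rightarrow> 'a \<Rightarrow> ereal" where
  "cut_time p v =
     Sup (ereal ` {t \<in> def_interval p v. rdist p (Exp p (t *\<^sub>R v)) = t * vnorm p v})"

definition Pre :: "'a \<Rightarrow> 'a \<Rightarrow> 'a set" where
  "Pre p q = {v \<in> E. 1 \<in> def_interval p v \<and> Exp p v = q}"

definition Logs :: "'a \<Rightarrow> 'a \<Rightarrow> 'a set" where
  "Logs p q = {v \<in> Pre p q. vnorm p v = rdist p q}"

definition log_domain :: "'a \<Rightarrow> 'a set" where
  "log_domain p = {q \<in> U. \<exists>!v. v \<in> Logs p q}"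

definition Log :: "'a \<Rightarrow> 'a \<Rightarrow> 'a" where
  "Log p q = (THE v. v \<in> Logs p q)"

definition joining_vector :: "'a \<Rightarrow> 'a \<Rightarrow> 'a" where
  "joining_vector p q = (THE v. v \<in> Pre p q)"

definition joining_geod :: "'a \<Rightarrow> 'a \<Rightarrow> real \<Rightarrow> 'a" where
  "joining_geod p q = geod p (joining_vector p q)"

end


section \<open>The Bures--Wasserstein metric\<close>

definition Sym :: "(real^'n^'n) set" where
  "Sym = {A. transpose A = A}"

definition SymPos :: "(real^'n^'n) set" where
  "SymPos = {A \<in> Sym. \<forall>x. x \<noteq> 0 \<longrightarrow> x \<bullet> (A *v x) > 0}"

definition SymPsd :: "(real^'n^'n) set" where
  "SymPsd = {A \<in> Sym. \<forall>x. x \<bullet> (A *v x) \<ge> 0}"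

definition symm :: "real^'n^'n \<Rightarrow> real^'n^'n" where
  "symm M = (1/2) *\<^sub>R (M + transpose M)"

definition msqrt :: "real^'n^'n \<Rightarrow> real^'n^'n" where
  "msqrt A = (THE B. B \<in> SymPsd \<and> B ** B = A)"

definition lyap :: "real^'n^'n \<Rightarrow> real^'n^'n \<Rightarrow> real^'n^'n" where
  "lyap \<Sigma> V = (THE Z. Z \<in> Sym \<and> \<Sigma> ** Z + Z ** \<Sigma> = V)"

text \<open>The symmetric bilinear form that polarizes \<open>V \<mapsto> trace (lyap \<Sigma> V ** \<Sigma> ** lyap \<Sigma> V)\<close>.\<close>
definition bw_metric :: "real^'n^'n \<Rightarrow> real^'n^'n \<Rightarrow> real^'n^'n \<Rightarrow> real" where
  "bw_metric \<Sigma> V W = trace (lyap \<Sigma> V ** \<Sigma> ** lyap \<Sigma> W)"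

interpretation bw: riem "Sym :: (real^'n^'n) set" SymPos bw_metric .

definition eigenvals :: "real^'n^'n \<Rightarrow> real set" where
  "eigenvals A = {l. \<exists>x. x \<noteq> 0 \<and> A *v x = l *\<^sub>R x}"

definition lam_max :: "real^'n^'n \<Rightarrow> real" where
  "lam_max A = Max (eigenvals A)"

definition lam_min :: "real^'n^'n \<Rightarrow> real" where
  "lam_min A = Min (eigenvals A)"

text \<open>The matrix \<open>\<Sigma>\<^sup>1\<^sup>/\<^sup>2 (\<Sigma>\<^sup>1\<^sup>/\<^sup>2 \<Lambda> \<Sigma>\<^sup>1\<^sup>/\<^sup>2)\<^sup>1\<^sup>/\<^sup>2 \<Sigma>\<^sup>-\<^sup>1\<^sup>/\<^sup>2\<close>.\<close>
definition cross_root :: "real^'n^'n \<Rightarrow> real^'n^'n \<Rightarrow> real^'n^'n" where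
  "cross_root \<Sigma> \<Lambda> =
     msqrt \<Sigma> ** msqrt (msqrt \<Sigma> ** \<Lambda> ** msqrt \<Sigma>) ** matrix_inv (msqrt \<Sigma>)"

end

theory Submission
  imports Defs
begin

text \<open>
  Everything is expressed through the symmetric matrix \<open>Z = lyap \<Sigma> \<Sigma>'\<close> that belongs to a velocity
  \<open>\<Sigma>'\<close> at \<open>\<Sigma>\<close>, so that \<open>\<Sigma>' = \<Sigma> Z + Z \<Sigma>\<close>. Differentiating the Lyapunov equation
  (\<open>has_vector_derivative_lyap\<close>) shows that the bilinear field \<open>- (Z\<^sub>U \<Sigma> Z\<^sub>V + Z\<^sub>V \<Sigma> Z\<^sub>U)\<close>, where
  \<open>Z\<^sub>U = lyap \<Sigma> U\<close>, is torsion free and metric, and the Koszul argument makes it the Levi-Civita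
  connection (\<open>levi_civita_eq_bw_christoffel\<close>). The geodesic equation becomes \<open>\<Sigma>'' = 2 Z \<Sigma> Z\<close>, which
  is the Riccati equation \<open>Z' = - Z\<^sup>2\<close>. With \<open>S = Z(0)\<close> and \<open>P(t) = 1 + t S\<close> this has the solution
  \<open>P Z = S\<close>, and then \<open>\<Sigma>(t) = P(t) \<Sigma>(0) P(t)\<close>; both identities are forced because the defects solve
  homogeneous linear equations (\<open>gronwall_zero\<close>, \<open>geodesic_from_unique\<close>). A geodesic cannot cross a
  zero of \<open>det P\<close> without leaving the positive definite matrices, so its maximal interval consists
  of the \<open>t\<close> with \<open>P(t)\<close> positive definite, which the extreme eigenvalues of \<open>S\<close> decide.

  Minimality comes from a calibration (\<open>length_lower_bound\<close>). Let \<open>Z\<^sub>s = (1 + s S)\<^sup>-\<^sup>1 S\<close> and let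
  \<open>c\<close> be any curve in the manifold, with \<open>c' = c Y + Y c\<close> and speed \<open>l = sqrt (tr (Y c Y))\<close>. For an increasing function
  \<open>s(t)\<close>, the Riccati equation and completion of the square give
  \<open>d/dt tr (Z\<^sub>s c) = 2 tr (Z\<^sub>s c Y) - s' tr (Z\<^sub>s c Z\<^sub>s) \<le> l\<^sup>2 / s'\<close>.
  When \<open>s\<close> runs from \<open>a\<close> to \<open>b\<close> in proportion to the arc length of \<open>c\<close> and \<open>c\<close> joins the points
  \<open>a\<close> and \<open>b\<close> of the geodesic, integration gives \<open>(b - a) tr (S \<Sigma> S) \<le> length(c)\<^sup>2 / (b - a)\<close>, so that
  \<open>length(c)\<close> is at least the length of the geodesic segment. This holds on the whole definition
  interval, so the cut time is the right end of that interval.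

  Finally, \<open>V\<close> is a preimage of \<open>\<Lambda>\<close> exactly when \<open>T = 1 + lyap \<Sigma> V\<close> is positive definite with
  \<open>T \<Sigma> T = \<Lambda>\<close>. Multiplying by \<open>\<Sigma>\<^sup>1\<^sup>/\<^sup>2\<close> on both sides turns this into
  \<open>(\<Sigma>\<^sup>1\<^sup>/\<^sup>2 T \<Sigma>\<^sup>1\<^sup>/\<^sup>2)\<^sup>2 = \<Sigma>\<^sup>1\<^sup>/\<^sup>2 \<Lambda> \<Sigma>\<^sup>1\<^sup>/\<^sup>2\<close>, and uniqueness of square roots determines \<open>T\<close>, hence the
  only preimage, which is a logarithm by minimality.
\<close>

section \<open>Matrix algebra\<close>

lemma trace_transpose: "trace (transpose A) = trace (A :: real^'n^'n)"
  by (simp add: trace_def transpose_def)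

lemma inner_matrix_eq_trace: "A \<bullet> B = trace (transpose A ** B)" for A B :: "real^'n^'n"
proof -
  have "A \<bullet> B = (\<Sum>i\<in>UNIV. \<Sum>j\<in>UNIV. A$i$j * B$i$j)"
    by (simp add: inner_vec_def)
  also have "\<dots> = (\<Sum>j\<in>UNIV. \<Sum>i\<in>UNIV. A$i$j * B$i$j)"
    by (rule sum.swap)
  finally show ?thesis
    by (simp add: trace_def matrix_matrix_mult_def transpose_def)
qed

lemma bilinear_matrix_mult: "bilinear ((**) :: real^'n^'n \<Rightarrow> real^'n^'n \<Rightarrow> real^'n^'n)"
  unfolding bilinear_def
  by (intro conjI allI linearI)
     (simp_all add: matrix_matrix_mult_def vec_eq_iff sum.distrib algebra_simps sum_distrib_left)

interpretation matrix_mult: bounded_bilinear "(**) :: real^'n^'n \<Rightarrow> real^'n^'n \<Rightarrow> real^'n^'n"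
  using bilinear_matrix_mult bilinear_conv_bounded_bilinear by blast

lemmas matrix_distribs = matrix_mult.add_left matrix_mult.add_right matrix_mult.diff_left
  matrix_mult.diff_right matrix_mult.scaleR_left matrix_mult.scaleR_right
  matrix_mult.minus_left matrix_mult.minus_right matrix_mul_assoc

lemma linear_trace: "linear (trace :: real^'n^'n \<Rightarrow> real)"
  by (rule linearI) (simp_all add: trace_def sum.distrib sum_distrib_left)

lemmas trace_linear_simps = linear_add[OF linear_trace] linear_diff[OF linear_trace]
  linear_neg[OF linear_trace] linear_cmul[OF linear_trace]

lemma linear_transpose: "linear (transpose :: real^'n^'n \<Rightarrow> real^'n^'n)"
  by (rule linearI) (simp_all add: transpose_def vec_eq_iff)

lemmas transpose_linear_simps = linear_add[OF linear_transpose] linear_diff[OF linear_transpose]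
  linear_neg[OF linear_transpose] linear_cmul[OF linear_transpose] matrix_transpose_mul

section \<open>Symmetric and positive definite matrices\<close>

lemma SymD: "A \<in> Sym \<Longrightarrow> transpose A = A"
  by (simp add: Sym_def)

lemma subspace_Sym: "subspace Sym"
  by (auto simp: subspace_def Sym_def transpose_linear_simps transpose_scalar)
     (simp add: transpose_def vec_eq_iff)

lemma Sym_0: "0 \<in> Sym" by (rule subspace_0[OF subspace_Sym])
lemma Sym_add: "A \<in> Sym \<Longrightarrow> B \<in> Sym \<Longrightarrow> A + B \<in> Sym" by (rule subspace_add[OF subspace_Sym])
lemma Sym_diff: "A \<in> Sym \<Longrightarrow> B \<in> Sym \<Longrightarrow> A - B \<in> Sym" by (rule subspace_diff[OF subspace_Sym])
lemma Sym_scaleR: "A \<in> Sym \<Longrightarrow> c *\<^sub>R A \<in> Sym" by (rule subspace_scale[OF subspace_Sym])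
lemma Sym_minus: "A \<in> Sym \<Longrightarrow> - A \<in> Sym" by (rule subspace_neg[OF subspace_Sym])
lemma Sym_mat: "mat c \<in> Sym" by (simp add: Sym_def)

lemmas Sym_intros = Sym_0 Sym_add Sym_diff Sym_scaleR Sym_minus Sym_mat

lemma Sym_sandwich: "A \<in> Sym \<Longrightarrow> B \<in> Sym \<Longrightarrow> A ** B ** A \<in> Sym"
  by (simp add: Sym_def matrix_transpose_mul matrix_mul_assoc)

lemma Sym_anticommutator: "A \<in> Sym \<Longrightarrow> B \<in> Sym \<Longrightarrow> A ** B + B ** A \<in> Sym"
  by (simp add: Sym_def transpose_linear_simps)

lemma Sym_inner: "A \<in> Sym \<Longrightarrow> x \<bullet> (A *v y) = (A *v x) \<bullet> y"
  by (metis SymD dot_lmul_matrix transpose_matrix_vector)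

lemma Sym_of_inner:
  assumes "\<And>x y. x \<bullet> (A *v y) = (A *v x) \<bullet> y"
  shows "A \<in> Sym"
proof -
  have "A *v x = transpose A *v x" for x
    by (rule vector_eq_rdot[THEN iffD1]) (use assms in \<open>simp add: dot_lmul_matrix\<close>)
  then show ?thesis
    by (simp add: Sym_def matrix_eq)
qed

lemma SymPos_Sym: "A \<in> SymPos \<Longrightarrow> A \<in> Sym"
  by (simp add: SymPos_def)

lemma SymPosD: "A \<in> SymPos \<Longrightarrow> x \<noteq> 0 \<Longrightarrow> 0 < x \<bullet> (A *v x)"
  by (simp add: SymPos_def)

lemma SymPos_SymPsd: "A \<in> SymPos \<Longrightarrow> A \<in> SymPsd"
  unfolding SymPos_def SymPsd_def by (auto intro: order.strict_implies_order) (metis inner_zero_left less_eq_real_def)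

lemma mat_1_SymPos: "mat 1 \<in> SymPos"
  by (simp add: SymPos_def Sym_mat)

lemma quadratic_nonneg_imp_linear_0:
  fixes a b :: real
  assumes "\<And>t. 0 \<le> a * t\<^sup>2 + 2 * b * t"
  shows "b = 0"
proof (rule ccontr)
  assume b: "b \<noteq> 0"
  define k where "k = \<bar>a\<bar> + 1"
  have k: "k > 0" "a - 2 * k < 0" by (auto simp: k_def)
  have "a * (- b / k)\<^sup>2 + 2 * b * (- b / k) = (b\<^sup>2 / k\<^sup>2) * (a - 2 * k)"
    using k(1) by (simp add: field_simps power2_eq_square)
  moreover have "(b\<^sup>2 / k\<^sup>2) * (a - 2 * k) < 0"
    using b k by (intro mult_pos_neg) auto
  ultimately show False using assms[of "- b / k"] by linarith
qed

text \<open>The Rayleigh quotient attains its minimum on the unit sphere of an invariant subspace, and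
  the first order condition at a minimizer says that it is an eigenvector.\<close>
lemma Rayleigh_min_on_subspace:
  fixes A :: "real^'n^'n"
  assumes A: "A \<in> Sym" and W: "subspace W" "\<And>x. x \<in> W \<Longrightarrow> A *v x \<in> W" and ne: "\<exists>x\<in>W. x \<noteq> 0"
  obtains v where "v \<in> W" "norm v = 1" "A *v v = (v \<bullet> (A *v v)) *\<^sub>R v"
    "\<And>x. x \<in> W \<Longrightarrow> (v \<bullet> (A *v v)) * (x \<bullet> x) \<le> x \<bullet> (A *v x)"
proof -
  let ?S = "sphere 0 1 \<inter> W"
  have "compact ?S"
    by (intro compact_Int_closed compact_sphere closed_subspace W)
  moreover obtain x0 where x0: "x0 \<in> W" "x0 \<noteq> 0" using ne by blast
  then have "x0 /\<^sub>R norm x0 \<in> ?S"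
    using W(1) by (auto intro: subspace_scale)
  moreover have "continuous_on ?S (\<lambda>x. x \<bullet> (A *v x))"
    by (intro continuous_intros linear_continuous_on matrix_vector_mul_bounded_linear)
  ultimately obtain v where v: "v \<in> ?S" "\<And>x. x \<in> ?S \<Longrightarrow> v \<bullet> (A *v v) \<le> x \<bullet> (A *v x)"
    using continuous_attains_inf[of ?S "\<lambda>x. x \<bullet> (A *v x)"] by blast
  define l where "l = v \<bullet> (A *v v)"
  have vv: "v \<bullet> v = 1" using v(1) by (simp add: dot_square_norm)
  have le: "l * (x \<bullet> x) \<le> x \<bullet> (A *v x)" if "x \<in> W" for x
  proof (cases "x = 0")
    case False
    then have "x /\<^sub>R norm x \<in> ?S" using that W(1) by (auto intro: subspace_scale)
    from v(2)[OF this] have "l \<le> (x \<bullet> (A *v x)) / (x \<bullet> x)"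
      using False by (simp add: l_def matrix_vector_mult_scaleR dot_square_norm
          power2_eq_square field_simps)
    then show ?thesis using False by (simp add: field_simps)
  qed simp
  define w where "w = A *v v - l *\<^sub>R v"
  have wW: "w \<in> W" unfolding w_def using v(1) W by (auto intro: subspace_diff subspace_scale)
  have "0 \<le> (w \<bullet> (A *v w) - l * (w \<bullet> w)) * t\<^sup>2 + 2 * (w \<bullet> w) * t" for t
  proof -
    have "v + t *\<^sub>R w \<in> W" using wW v(1) W(1) by (auto intro: subspace_add subspace_scale)
    note le[OF this]
    moreover have "v \<bullet> (A *v w) = w \<bullet> (A *v v)"
      using Sym_inner[OF A, of v w] by (simp add: inner_commute)
    moreover have "w \<bullet> (A *v v) = w \<bullet> w + l * (w \<bullet> v)"
      by (simp add: w_def inner_diff_right inner_diff_left inner_commute algebra_simps)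
    ultimately show ?thesis using vv
      by (simp add: matrix_vector_right_distrib matrix_vector_mult_scaleR inner_add_left
          inner_add_right algebra_simps power2_eq_square inner_commute[of v w] flip: l_def)
  qed
  from quadratic_nonneg_imp_linear_0[OF this] have "w = 0" by simp
  then have "A *v v = l *\<^sub>R v" by (simp add: w_def)
  then show thesis
    using v(1) le vv by (intro that[of v]) (auto simp flip: l_def)
qed

lemma orthogonal_eigenvectors:
  assumes A: "A \<in> Sym" and "A *v x = a *\<^sub>R x" "A *v y = b *\<^sub>R y" "a \<noteq> b"
  shows "orthogonal x y"
proof -
  have "b * (x \<bullet> y) = a * (x \<bullet> y)"
    using Sym_inner[OF A, of x y] assms by simp
  then show ?thesis using \<open>a \<noteq> b\<close> by (simp add: orthogonal_def)
qed

text \<open>Eigenvectors for distinct eigenvalues are orthogonal, hence independent. Finiteness is what makes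
  \<open>Min\<close> and \<open>Max\<close> in \<open>lam_min\<close> and \<open>lam_max\<close> meaningful.\<close>
lemma finite_eigenvals:
  fixes A :: "real^'n^'n"
  assumes A: "A \<in> Sym"
  shows "finite (eigenvals A)"
proof -
  have "\<exists>f. \<forall>l\<in>eigenvals A. f l \<noteq> 0 \<and> A *v f l = l *\<^sub>R f l"
    unfolding eigenvals_def by (intro bchoice) auto
  then obtain f where f: "\<And>l. l \<in> eigenvals A \<Longrightarrow> f l \<noteq> 0 \<and> A *v f l = l *\<^sub>R f l" by blast
  have inj: "inj_on f (eigenvals A)"
    by (rule inj_onI) (metis f scaleR_cancel_right)
  have "pairwise orthogonal (f ` eigenvals A)"
    unfolding pairwise_image by (rule pairwiseI) (use f orthogonal_eigenvectors[OF A] in blast)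
  then have "independent (f ` eigenvals A)"
    by (rule pairwise_orthogonal_independent) (use f in force)
  then show ?thesis
    using inj finite_imageD independent_imp_finite by blast
qed

text \<open>The minimum of the Rayleigh quotient is an eigenvalue, and it is below every other eigenvalue
  because each of these is a value of the quotient.\<close>
lemma lam_min_Sym:
  fixes A :: "real^'n^'n"
  assumes A: "A \<in> Sym"
  shows "lam_min A \<in> eigenvals A" and "lam_min A * (x \<bullet> x) \<le> x \<bullet> (A *v x)"
proof -
  have "axis (undefined :: 'n) (1::real) \<noteq> 0" by (simp add: axis_eq_0_iff)
  then obtain v :: "real^'n" where v: "norm v = 1" "A *v v = (v \<bullet> (A *v v)) *\<^sub>R v"
    "\<And>x. (v \<bullet> (A *v v)) * (x \<bullet> x) \<le> x \<bullet> (A *v x)"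
    using Rayleigh_min_on_subspace[OF A, of UNIV] by auto
  define l where "l = v \<bullet> (A *v v)"
  have l: "l \<in> eigenvals A" using v(1,2) unfolding eigenvals_def l_def by (auto intro!: exI[of _ v])
  have "l \<le> m" if m: "m \<in> eigenvals A" for m
  proof -
    obtain x where "x \<noteq> 0" "A *v x = m *\<^sub>R x" using m by (auto simp: eigenvals_def)
    then show ?thesis using v(3)[of x] by (simp flip: l_def)
  qed
  then have "lam_min A = l"
    unfolding lam_min_def by (intro Min_eqI finite_eigenvals[OF A] l)
  then show "lam_min A \<in> eigenvals A" "lam_min A * (x \<bullet> x) \<le> x \<bullet> (A *v x)"
    using l v(3) by (auto simp: l_def)
qed

lemma eigenvals_minus: "eigenvals (- A) = uminus ` eigenvals A" for A :: "real^'n^'n"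
proof -
  have neg: "(- B) *v x = - (B *v x)" for B :: "real^'n^'n" and x
    using matrix_vector_mult_diff_rdistrib[of 0 B x] by simp
  have *: "- l \<in> eigenvals (- B)" if "l \<in> eigenvals B" for B :: "real^'n^'n" and l
    using that unfolding eigenvals_def by (auto simp: neg)
  show ?thesis
    using *[of _ A] *[of _ "- A"] by (auto simp: image_iff) (metis minus_minus)
qed

lemma lam_max_Sym:
  fixes A :: "real^'n^'n"
  assumes A: "A \<in> Sym"
  shows "lam_max A \<in> eigenvals A" and "x \<bullet> (A *v x) \<le> lam_max A * (x \<bullet> x)"
proof -
  have mA: "- A \<in> Sym" using A by (rule Sym_minus)
  have neg: "(- A) *v x = - (A *v x)" 
    using matrix_vector_mult_diff_rdistrib[of 0 A x] by simp
  note fin = finite_eigenvals[OF A]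
  have ne: "eigenvals A \<noteq> {}"
    using lam_min_Sym(1)[OF A] by blast
  have "lam_min (- A) = - lam_max A"
    unfolding lam_min_def lam_max_def eigenvals_minus
    by (rule Min_eqI) (use fin ne in auto)
  then show "x \<bullet> (A *v x) \<le> lam_max A * (x \<bullet> x)"
    using lam_min_Sym(2)[OF mA, of x] by (simp add: neg)
  show "lam_max A \<in> eigenvals A"
    unfolding lam_max_def by (rule Max_in[OF fin ne])
qed

lemma SymPos_coercive:
  fixes A :: "real^'n^'n"
  assumes "A \<in> SymPos"
  obtains m where "m > 0" "\<And>x. m * (x \<bullet> x) \<le> x \<bullet> (A *v x)"
proof -
  have A: "A \<in> Sym" using assms by (rule SymPos_Sym)
  obtain x where x: "x \<noteq> 0" "A *v x = lam_min A *\<^sub>R x"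
    using lam_min_Sym(1)[OF A] by (auto simp: eigenvals_def)
  have "lam_min A > 0"
    using SymPosD[OF assms x(1)] x(2) zero_less_mult_pos2[of "lam_min A" "x \<bullet> x"] x(1) by simp
  then show thesis using that lam_min_Sym(2)[OF A] by blast
qed

lemma SymPos_ker: "A \<in> SymPos \<Longrightarrow> A *v x = 0 \<Longrightarrow> x = 0"
  using SymPosD by fastforce

lemma SymPos_matrix_inv:
  fixes A :: "real^'n^'n"
  assumes "A \<in> SymPos"
  shows "matrix_inv A ** A = mat 1" "A ** matrix_inv A = mat 1" "matrix_inv A \<in> Sym"
proof -
  obtain B where "B ** A = mat 1"
    using matrix_left_invertible_ker[of A] SymPos_ker[OF assms] by blast
  then have "A ** B = mat 1" by (simp add: matrix_left_right_inverse)
  with \<open>B ** A = mat 1\<close> have "invertible A" unfolding invertible_def by blast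
  then show 1: "matrix_inv A ** A = mat 1" "A ** matrix_inv A = mat 1"
    unfolding matrix_inv_def invertible_def by (auto dest!: someI_ex[of "\<lambda>B. A ** B = mat 1 \<and> B ** A = mat 1"])
  have "transpose (matrix_inv A) ** A = mat 1"
    using arg_cong[OF 1(2), of transpose] SymD[OF SymPos_Sym[OF assms]]
    by (simp add: matrix_transpose_mul)
  then have "transpose (matrix_inv A) ** A ** matrix_inv A = matrix_inv A" by simp
  then show "matrix_inv A \<in> Sym" by (simp add: Sym_def 1 flip: matrix_mul_assoc)
qed

lemma SymPos_sandwich:
  fixes A :: "real^'n^'n"
  assumes A: "A \<in> SymPos" and P: "P \<in> Sym" and ker: "\<And>x. P *v x = 0 \<Longrightarrow> x = 0"
  shows "P ** A ** P \<in> SymPos"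
proof -
  have "0 < x \<bullet> ((P ** A ** P) *v x)" if "x \<noteq> 0" for x
  proof -
    have "x \<bullet> ((P ** A ** P) *v x) = (P *v x) \<bullet> (A *v (P *v x))"
      using Sym_inner[OF P] by (simp flip: matrix_vector_mul_assoc)
    then show ?thesis using SymPosD[OF A] ker that by metis
  qed
  then show ?thesis
    using Sym_sandwich[OF P SymPos_Sym[OF A]] by (simp add: SymPos_def)
qed

section \<open>The square root of a positive definite matrix\<close>

text \<open>A maximal orthonormal set of eigenvectors spans: its orthogonal complement is invariant, so it
  would otherwise contain one more eigenvector.\<close>
theorem Sym_orthonormal_eigenbasis:
  fixes A :: "real^'n^'n"
  assumes A: "A \<in> Sym"
  obtains B where "finite B" "pairwise orthogonal B" "span B = UNIV"
    "\<And>b. b \<in> B \<Longrightarrow> norm b = 1 \<and> A *v b = (b \<bullet> (A *v b)) *\<^sub>R b"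
proof -
  define P where "P B \<longleftrightarrow> pairwise orthogonal B \<and> (\<forall>b\<in>B. norm b = 1 \<and> A *v b = (b \<bullet> (A *v b)) *\<^sub>R b)"
    for B :: "(real^'n) set"
  have ind: "independent B" if "P B" for B
    using that pairwise_orthogonal_independent[of B] by (force simp: P_def)
  have "P {}" by (simp add: P_def)
  moreover have "\<forall>B. P B \<longrightarrow> card B < Suc DIM(real^'n)"
    using ind independent_bound by (metis less_Suc_eq_le)
  ultimately obtain B where B: "P B" "\<And>C. P C \<Longrightarrow> card C \<le> card B"
    using ex_has_greatest_nat[of P "{}" card] by blast
  have fin: "finite B" using ind[OF B(1)] by (rule independent_imp_finite)
  have "span B = UNIV"
  proof (rule ccontr)
    assume "span B \<noteq> UNIV"
    then have "dim B < DIM(real^'n)"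
      by (metis dim_eq_full dim_subset_UNIV le_neq_implies_less)
    then obtain y where y: "y \<noteq> 0" "\<And>b. b \<in> span B \<Longrightarrow> orthogonal y b"
      using orthogonal_to_subspace_exists by blast
    define W where "W = {x. \<forall>b\<in>B. b \<bullet> x = 0}"
    have "y \<in> W"
      using y(2) by (auto simp: W_def orthogonal_def inner_commute span_base)
    have "subspace W" by (auto simp: subspace_def W_def inner_add_right)
    moreover have "A *v x \<in> W" if "x \<in> W" for x
    proof -
      have "b \<bullet> (A *v x) = 0" if "b \<in> B" for b
      proof -
        have "b \<bullet> (A *v x) = (A *v b) \<bullet> x" by (rule Sym_inner[OF A])
        also have "A *v b = (b \<bullet> (A *v b)) *\<^sub>R b" using B(1) that by (simp add: P_def)
        finally show ?thesis using \<open>x \<in> W\<close> that by (simp add: W_def)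
      qed
      then show ?thesis by (simp add: W_def)
    qed
    moreover have "\<exists>x\<in>W. x \<noteq> 0" using y(1) \<open>y \<in> W\<close> by blast
    ultimately obtain v where v: "v \<in> W" "norm v = 1" "A *v v = (v \<bullet> (A *v v)) *\<^sub>R v"
      by (rule Rayleigh_min_on_subspace[OF A])
    have "P (insert v B)"
      using B(1) v by (auto simp: P_def pairwise_insert W_def orthogonal_def inner_commute)
    moreover have "v \<notin> B"
      using v by (auto simp: W_def dot_square_norm)
    ultimately show False using B(2)[of "insert v B"] fin by simp
  qed
  then show thesis using that[of B] fin B(1) by (auto simp: P_def)
qed

text \<open>The root keeps an orthonormal eigenbasis and takes the square roots of the eigenvalues.\<close>
lemma SymPos_sqrt_exists:
  fixes A :: "real^'n^'n"
  assumes A: "A \<in> SymPos"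
  obtains R where "R \<in> SymPos" "R ** R = A"
proof -
  obtain B where B: "finite B" "pairwise orthogonal B" "span B = UNIV"
    "\<And>b. b \<in> B \<Longrightarrow> norm b = 1 \<and> A *v b = (b \<bullet> (A *v b)) *\<^sub>R b"
    using Sym_orthonormal_eigenbasis[OF SymPos_Sym[OF A]] by blast
  define l where "l b = b \<bullet> (A *v b)" for b
  have lpos: "l b > 0" if "b \<in> B" for b
    using SymPosD[OF A, of b] B(4)[OF that] by (force simp: l_def)
  have Ab: "A *v b = l b *\<^sub>R b" if "b \<in> B" for b
    using B(4)[OF that] by (simp add: l_def)
  define f where "f x = (\<Sum>b\<in>B. (sqrt (l b) * (b \<bullet> x)) *\<^sub>R b)" for x
  have lin: "linear f"
    by (rule linearI)
       (simp_all add: f_def sum.distrib inner_add_right algebra_simps scaleR_sum_right)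
  define R where "R = matrix f"
  have Rf: "R *v x = f x" for x unfolding R_def using lin by (simp add: linear_matrix_vector_mul_eq matrix_works)
  have inner: "y \<bullet> f x = (\<Sum>b\<in>B. sqrt (l b) * (b \<bullet> x) * (b \<bullet> y))" for x y
    by (simp add: f_def inner_sum_right inner_commute)
  have sym: "R \<in> Sym"
  proof (rule Sym_of_inner)
    show "x \<bullet> (R *v y) = (R *v x) \<bullet> y" for x y
      unfolding Rf inner_commute[of "f x" y] inner by (rule sum.cong[OF refl]) (simp add: ac_simps)
  qed
  have "0 < x \<bullet> (R *v x)" if "x \<noteq> 0" for x
  proof -
    have "\<exists>b\<in>B. b \<bullet> x \<noteq> 0"
    proof (rule ccontr)
      assume "\<not> (\<exists>b\<in>B. b \<bullet> x \<noteq> 0)"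
      then have "orthogonal x b" if "b \<in> B" for b
        using that by (simp add: orthogonal_def inner_commute)
      then have "orthogonal x x"
        using orthogonal_to_span[of x B x] B(3) by simp
      with that show False by (simp add: orthogonal_def)
    qed
    then obtain b where b: "b \<in> B" "b \<bullet> x \<noteq> 0" by blast
    show ?thesis unfolding Rf inner
      by (rule sum_pos2[OF B(1) b(1)])
         (use b lpos in \<open>auto simp: mult.assoc zero_less_mult_iff mult_nonneg_nonneg less_imp_le\<close>)
  qed
  with sym have "R \<in> SymPos" by (simp add: SymPos_def)
  moreover have "(R ** R) *v x = A *v x" for x
  proof -
    have fb: "f b = sqrt (l b) *\<^sub>R b" if b: "b \<in> B" for b
    proof -
      have "f b = (\<Sum>c\<in>B. if c = b then sqrt (l b) *\<^sub>R b else 0)"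
        unfolding f_def using B b
        by (intro sum.cong refl) (auto simp: pairwise_def orthogonal_def dot_square_norm)
      then show ?thesis using B(1) b by simp
    qed
    have "(R ** R) *v b = A *v b" if "b \<in> B" for b
      using that lpos[OF that] fb Ab
      by (simp add: Rf linear_cmul[OF lin] flip: matrix_vector_mul_assoc)
    with B(3) show ?thesis
      using linear_eq_on_span[of "(*v) (R ** R)" "(*v) A" B x] by simp
  qed
  then have "R ** R = A" by (simp add: matrix_eq)
  ultimately show thesis by (rule that)
qed

text \<open>Any positive semidefinite root \<open>R\<close> is determined on an eigenbasis of \<open>A\<close>: if \<open>A b = l b\<close>, then
  \<open>(R + sqrt l) (R - sqrt l) b = 0\<close>, and \<open>R + sqrt l\<close> is injective because \<open>l > 0\<close>.\<close>
lemma SymPsd_sqrt_unique: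
  fixes A :: "real^'n^'n"
  assumes A: "A \<in> SymPos" and B: "B \<in> SymPsd" "B ** B = A" and C: "C \<in> SymPsd" "C ** C = A"
  shows "B = C"
proof -
  obtain E where "finite E" "pairwise orthogonal E" and E: "span E = UNIV"
    "\<And>b. b \<in> E \<Longrightarrow> norm b = 1 \<and> A *v b = (b \<bullet> (A *v b)) *\<^sub>R b"
    using Sym_orthonormal_eigenbasis[OF SymPos_Sym[OF A]] by metis
  have act: "R *v b = sqrt (b \<bullet> (A *v b)) *\<^sub>R b"
    if b: "b \<in> E" and R: "R \<in> SymPsd" "R ** R = A" for b R
  proof -
    define l where "l = b \<bullet> (A *v b)"
    have nb: "norm b = 1" "A *v b = l *\<^sub>R b" using E(2)[OF b] by (auto simp: l_def)
    then have l: "l > 0" unfolding l_def using SymPosD[OF A, of b] by force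
    define w where "w = R *v b - sqrt l *\<^sub>R b"
    have "R *v w + sqrt l *\<^sub>R w = 0"
    proof -
      have "R *v w = A *v b - sqrt l *\<^sub>R (R *v b)"
        using R(2) by (simp add: w_def matrix_vector_mult_diff_distrib matrix_vector_mult_scaleR
            matrix_vector_mul_assoc)
      then show ?thesis using l nb(2) by (simp add: w_def scaleR_diff_right)
    qed
    then have "w \<bullet> (R *v w) + sqrt l * (w \<bullet> w) = 0"
      by (metis inner_add_right inner_scaleR_right inner_zero_right)
    moreover have "0 \<le> w \<bullet> (R *v w)" using R(1) by (simp add: SymPsd_def)
    moreover have "0 \<le> sqrt l * (w \<bullet> w)" using l by simp
    ultimately have "sqrt l * (w \<bullet> w) = 0" by linarith
    then show ?thesis using l by (simp add: w_def flip: l_def)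
  qed
  have "B *v x = C *v x" for x
    using linear_eq_on_span[of "(*v) B" "(*v) C" E x] by (simp add: E(1) act B C)
  then show ?thesis by (simp add: matrix_eq)
qed

lemma msqrt_eqI:
  fixes A :: "real^'n^'n"
  assumes "A \<in> SymPos" "R \<in> SymPos" "R ** R = A"
  shows "msqrt A = R"
  unfolding msqrt_def
proof (rule the_equality)
  show R: "R \<in> SymPsd \<and> R ** R = A" using assms SymPos_SymPsd by blast
  show "B = R" if "B \<in> SymPsd \<and> B ** B = A" for B
    using SymPsd_sqrt_unique[OF assms(1), of B R] that R by blast
qed

lemma msqrt_SymPos:
  fixes A :: "real^'n^'n"
  assumes "A \<in> SymPos"
  shows "msqrt A \<in> SymPos" "msqrt A ** msqrt A = A"
proof -
  obtain R where R: "R \<in> SymPos" "R ** R = A" using SymPos_sqrt_exists[OF assms] .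
  then have "msqrt A = R" by (rule msqrt_eqI[OF assms])
  with R show "msqrt A \<in> SymPos" "msqrt A ** msqrt A = A" by auto
qed

section \<open>The Lyapunov operator\<close>

text \<open>Both sides are sums over the columns of \<open>Z\<close>.\<close>
lemma trace_sandwich_lower:
  fixes A Z :: "real^'n^'n"
  assumes "\<And>x. m * (x \<bullet> x) \<le> x \<bullet> (A *v x)"
  shows "m * (Z \<bullet> Z) \<le> trace (transpose Z ** A ** Z)"
proof -
  have "trace (transpose Z ** A ** Z) = (\<Sum>j\<in>UNIV. column j Z \<bullet> (A *v column j Z))"
    unfolding matrix_mul_assoc[symmetric]
    by (simp add: trace_def matrix_matrix_mult_def matrix_vector_mult_def transpose_def column_def
        inner_vec_def)
  moreover have "Z \<bullet> Z = (\<Sum>j\<in>UNIV. column j Z \<bullet> column j Z)"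
    by (simp add: inner_matrix_eq_trace trace_def matrix_matrix_mult_def transpose_def column_def
        inner_vec_def)
  ultimately show ?thesis
    using assms by (simp add: sum_distrib_left sum_mono)
qed

lemma trace_sandwich_nonneg:
  fixes A Z :: "real^'n^'n"
  assumes "A \<in> SymPos" "Z \<in> Sym"
  shows "0 \<le> trace (Z ** A ** Z)"
proof -
  have "0 * (x \<bullet> x) \<le> x \<bullet> (A *v x)" for x
    using SymPos_SymPsd[OF assms(1)] by (simp add: SymPsd_def)
  from trace_sandwich_lower[OF this, of Z] show ?thesis by (simp add: SymD[OF assms(2)])
qed

lemma lyapunov_inner_lower:
  fixes A Z :: "real^'n^'n"
  assumes "\<And>x. m * (x \<bullet> x) \<le> x \<bullet> (A *v x)"
  shows "2 * m * (Z \<bullet> Z) \<le> Z \<bullet> (A ** Z + Z ** A)"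
proof -
  have "transpose Z \<bullet> transpose Z = Z \<bullet> Z"
    unfolding inner_matrix_eq_trace transpose_transpose by (rule trace_mul_sym)
  then have "m * (Z \<bullet> Z) \<le> trace (Z ** A ** transpose Z)"
    using trace_sandwich_lower[OF assms, of "transpose Z"] by simp
  also have "\<dots> = trace (transpose Z ** (Z ** A))" by (rule trace_mul_sym)
  finally have "m * (Z \<bullet> Z) \<le> Z \<bullet> (Z ** A)"
    by (simp only: inner_matrix_eq_trace)
  moreover have "m * (Z \<bullet> Z) \<le> Z \<bullet> (A ** Z)"
    using trace_sandwich_lower[OF assms, of Z] by (simp only: inner_matrix_eq_trace matrix_mul_assoc)
  ultimately show ?thesis by (simp add: inner_add_right)
qed

lemma norm_lower_of_inner_lower:
  fixes x y :: "'a::real_inner"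
  assumes "m * (x \<bullet> x) \<le> x \<bullet> y"
  shows "m * norm x \<le> norm y"
proof (cases "x = 0")
  case False
  have "m * norm x * norm x \<le> norm y * norm x"
    using assms norm_cauchy_schwarz[of x y] by (simp add: dot_square_norm power2_eq_square mult.commute mult.left_commute)
  then show ?thesis using False by simp
qed simp

text \<open>Uniform coercivity: one constant serves for all \<open>B\<close> close to \<open>A\<close>. It bounds the inverse
  Lyapunov operators locally, which is all that continuity and differentiability of \<open>lyap\<close> require.\<close>
lemma lyapunov_norm_lower_near:
  fixes A :: "real^'n^'n"
  assumes "A \<in> SymPos"
  obtains m where "m > 0" "\<forall>\<^sub>F B in nhds A. \<forall>Z. m * norm Z \<le> norm (B ** Z + Z ** B)"
proof -
  obtain m where m: "m > 0" "\<And>x. m * (x \<bullet> x) \<le> x \<bullet> (A *v x)"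
    using SymPos_coercive[OF assms] by blast
  have "\<exists>K>0. \<forall>(X :: real^'n^'n) (Y :: real^'n^'n). norm (X ** Y) \<le> norm X * norm Y * K"
    by (rule matrix_mult.pos_bounded)
  then obtain K where K: "K > 0" "\<forall>(X :: real^'n^'n) (Y :: real^'n^'n). norm (X ** Y) \<le> norm X * norm Y * K"
    by blast
  have "m * norm Z \<le> norm (B ** Z + Z ** B)" if B: "norm (B - A) < m / (2 * K)" for B Z
  proof (rule norm_lower_of_inner_lower)
    have "norm ((B - A) ** Z + Z ** (B - A)) \<le> norm (B - A) * norm Z * K + norm Z * norm (B - A) * K"
      by (intro norm_triangle_le add_mono K(2)[rule_format])
    also have "\<dots> = (2 * K * norm (B - A)) * norm Z" by simp
    also have "\<dots> \<le> m * norm Z"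
      using B K(1) by (intro mult_right_mono) (simp_all add: field_simps)
    finally have "\<bar>Z \<bullet> ((B - A) ** Z + Z ** (B - A))\<bar> \<le> m * (Z \<bullet> Z)"
      using Cauchy_Schwarz_ineq2[of Z "(B - A) ** Z + Z ** (B - A)"]
        mult_left_mono[of "norm ((B - A) ** Z + Z ** (B - A))" "m * norm Z" "norm Z"]
      by (simp add: dot_square_norm power2_eq_square mult.left_commute)
    moreover have "Z \<bullet> (B ** Z + Z ** B) =
        Z \<bullet> (A ** Z + Z ** A) + Z \<bullet> ((B - A) ** Z + Z ** (B - A))"
      by (simp add: matrix_distribs inner_add_right inner_diff_right)
    ultimately show "m * (Z \<bullet> Z) \<le> Z \<bullet> (B ** Z + Z ** B)"
      using lyapunov_inner_lower[OF m(2), of Z] by linarith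
  qed
  moreover have "\<forall>\<^sub>F B in nhds A. norm (B - A) < m / (2 * K)"
    unfolding eventually_nhds_metric using m(1) K(1)
    by (intro exI[of _ "m / (2 * K)"]) (auto simp: dist_norm)
  ultimately show thesis
    by (intro that[OF m(1)]) (auto elim: eventually_mono)
qed

lemma lyapunov_injective:
  fixes A Z :: "real^'n^'n"
  assumes "A \<in> SymPos" "A ** Z + Z ** A = 0"
  shows "Z = 0"
proof -
  obtain m where m: "m > 0" "\<And>x. m * (x \<bullet> x) \<le> x \<bullet> (A *v x)"
    using SymPos_coercive[OF assms(1)] by blast
  have "2 * m * (Z \<bullet> Z) \<le> 0" using lyapunov_inner_lower[OF m(2), of Z] assms(2) by simp
  then show ?thesis using m(1) by (simp add: mult_le_0_iff) (metis inner_gt_zero_iff not_less)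
qed

text \<open>On the space of all matrices the operator is injective, hence surjective; the transpose of a
  solution for symmetric \<open>V\<close> is again a solution.\<close>
lemma lyapunov_solvable:
  fixes A V :: "real^'n^'n"
  assumes A: "A \<in> SymPos" and V: "V \<in> Sym"
  obtains Z where "Z \<in> Sym" "A ** Z + Z ** A = V"
proof -
  let ?L = "\<lambda>Z. A ** Z + Z ** A"
  have lin: "linear ?L" by (rule linearI) (simp_all add: matrix_distribs scaleR_add_right)
  have "inj ?L"
    using lyapunov_injective[OF A] unfolding linear_injective_0[OF lin] by blast
  then have "surj ?L" by (rule linear_injective_imp_surjective[OF lin]) simp
  then have "\<exists>Z. V = ?L Z" by (rule surjD)
  then obtain Z where "V = ?L Z" by (rule exE)
  then have Z: "?L Z = V" by (rule sym)
  have "?L (transpose Z) = transpose (?L Z)"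
    using SymD[OF SymPos_Sym[OF A]] by (simp add: transpose_linear_simps add.commute)
  also have "\<dots> = ?L Z" using SymD[OF V] Z by simp
  finally have "transpose Z = Z" using injD[OF \<open>inj ?L\<close>, of "transpose Z" Z] by blast
  then show thesis using that[of Z] Z by (simp add: Sym_def)
qed

lemma lyap_eqI:
  fixes A V Z :: "real^'n^'n"
  assumes "A \<in> SymPos" "Z \<in> Sym" "A ** Z + Z ** A = V"
  shows "lyap A V = Z"
  unfolding lyap_def
proof (rule the_equality)
  show "Z \<in> Sym \<and> A ** Z + Z ** A = V" using assms by simp
  show "Y = Z" if "Y \<in> Sym \<and> A ** Y + Y ** A = V" for Y
  proof -
    have "A ** (Y - Z) + (Y - Z) ** A = (A ** Y + Y ** A) - (A ** Z + Z ** A)"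
      by (simp add: matrix_distribs)
    then have "A ** (Y - Z) + (Y - Z) ** A = 0" using that assms(3) by simp
    from lyapunov_injective[OF assms(1) this] show ?thesis by simp
  qed
qed

lemma
  fixes A V :: "real^'n^'n"
  assumes "A \<in> SymPos" "V \<in> Sym"
  shows lyap_Sym: "lyap A V \<in> Sym"
    and lyap_equation: "A ** lyap A V + lyap A V ** A = V"
proof -
  obtain Z where Z: "Z \<in> Sym" "A ** Z + Z ** A = V" using lyapunov_solvable[OF assms] .
  with lyap_eqI[OF assms(1)] have "lyap A V = Z" by blast
  with Z show "lyap A V \<in> Sym" "A ** lyap A V + lyap A V ** A = V" by auto
qed

lemma lyap_linear_combination:
  fixes A V W :: "real^'n^'n"
  assumes "A \<in> SymPos" "V \<in> Sym" "W \<in> Sym"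
  shows "lyap A (a *\<^sub>R V + b *\<^sub>R W) = a *\<^sub>R lyap A V + b *\<^sub>R lyap A W"
proof (rule lyap_eqI[OF assms(1)])
  let ?Z = "a *\<^sub>R lyap A V + b *\<^sub>R lyap A W"
  show "?Z \<in> Sym" using assms by (intro Sym_intros lyap_Sym)
  have "A ** ?Z + ?Z ** A =
      a *\<^sub>R (A ** lyap A V + lyap A V ** A) + b *\<^sub>R (A ** lyap A W + lyap A W ** A)"
    by (simp add: matrix_distribs algebra_simps)
  then show "A ** ?Z + ?Z ** A = a *\<^sub>R V + b *\<^sub>R W" using assms by (simp add: lyap_equation)
qed

subsection \<open>Differentiating the Lyapunov operator along curves\<close>

lemma has_vector_derivative_0_by_comparison:
  assumes G: "(G has_vector_derivative 0) (at t)" and "G t = 0" "E t = 0"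
    and le: "\<forall>\<^sub>F s in at t. norm (E s) \<le> K * norm (G s)"
  shows "(E has_vector_derivative 0) (at t)"
proof -
  have "((\<lambda>s. norm (G s) / norm (s - t)) \<longlongrightarrow> 0) (at t)"
    using G \<open>G t = 0\<close> by (simp add: has_vector_derivative_def has_derivative_iff_norm)
  then have lim: "((\<lambda>s. K * (norm (G s) / norm (s - t))) \<longlongrightarrow> 0) (at t)"
    by (rule tendsto_mult_right_zero)
  have "((\<lambda>s. norm (E s) / norm (s - t)) \<longlongrightarrow> 0) (at t)"
    by (rule Lim_null_comparison[OF _ lim])
       (use le in \<open>auto elim!: eventually_mono simp: divide_right_mono\<close>)
  then show ?thesis
    using \<open>E t = 0\<close> by (simp add: has_vector_derivative_def has_derivative_iff_norm)
qed

lemma Sym_vector_derivative: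
  fixes c :: "real \<Rightarrow> real^'n^'n"
  assumes c: "(c has_vector_derivative c') (at t)" and T: "open T" "t \<in> T" "\<And>s. s \<in> T \<Longrightarrow> c s \<in> Sym"
  shows "c' \<in> Sym"
proof -
  have "((\<lambda>s. transpose (c s)) has_vector_derivative transpose c') (at t)"
    by (rule bounded_linear.has_vector_derivative[OF linear_transpose[unfolded linear_conv_bounded_linear] c])
  then have "(c has_vector_derivative transpose c') (at t)"
    by (rule has_vector_derivative_transform_within_open[OF _ T(1,2)]) (use T(3) SymD in auto)
  with c have "transpose c' = c'" by (rule vector_derivative_unique_at[symmetric])
  then show ?thesis by (simp add: Sym_def)
qed

lemma has_vector_derivative_matrix_mult:
  fixes X Y :: "real \<Rightarrow> real^'n^'n"
  assumes "(X has_vector_derivative X') (at t within T)" "(Y has_vector_derivative Y') (at t within T)"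
  shows "((\<lambda>s. X s ** Y s) has_vector_derivative (X t ** Y' + X' ** Y t)) (at t within T)"
  by (rule matrix_mult.has_vector_derivative[OF assms])

lemma has_vector_derivative_trace:
  fixes X :: "real \<Rightarrow> real^'n^'n"
  assumes "(X has_vector_derivative X') F"
  shows "((\<lambda>s. trace (X s)) has_vector_derivative trace X') F"
  by (rule bounded_linear.has_vector_derivative[OF linear_trace[unfolded linear_conv_bounded_linear] assms])

text \<open>The value is what formal differentiation of \<open>c Z + Z c = v\<close> gives: \<open>c Z' + Z' c = v' - c' Z - Z c'\<close>.
  With \<open>W\<close> denoting this candidate, the Lyapunov operator at \<open>c s\<close> maps the remainder
  \<open>E s = Z s - Z t - (s - t) W\<close> to a quantity \<open>G s\<close> that is visibly of order \<open>o(s - t)\<close>, and uniform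
  coercivity transfers this to \<open>E\<close>.\<close>
theorem has_vector_derivative_lyap:
  fixes c v :: "real \<Rightarrow> real^'n^'n"
  assumes c: "(c has_vector_derivative c') (at t)" and v: "(v has_vector_derivative v') (at t)"
    and T: "open T" "t \<in> T" "\<And>s. s \<in> T \<Longrightarrow> c s \<in> SymPos" "\<And>s. s \<in> T \<Longrightarrow> v s \<in> Sym"
  shows "((\<lambda>s. lyap (c s) (v s)) has_vector_derivative
           lyap (c t) (v' - (c' ** lyap (c t) (v t) + lyap (c t) (v t) ** c'))) (at t)"
proof -
  define Z where "Z s = lyap (c s) (v s)" for s
  have c'Sym: "c' \<in> Sym" using Sym_vector_derivative[OF c T(1,2)] T(3) SymPos_Sym by blast
  have v'Sym: "v' \<in> Sym" using Sym_vector_derivative[OF v T(1,2)] T(4) by blast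
  have Zeq: "c s ** Z s + Z s ** c s = v s" if "s \<in> T" for s
    unfolding Z_def by (rule lyap_equation[OF T(3)[OF that] T(4)[OF that]])
  have ZSym: "Z t \<in> Sym"
    unfolding Z_def by (rule lyap_Sym[OF T(3)[OF T(2)] T(4)[OF T(2)]])
  define W where "W = lyap (c t) (v' - (c' ** Z t + Z t ** c'))"
  have Weq: "c t ** W + W ** c t = v' - (c' ** Z t + Z t ** c')"
    unfolding W_def using T c'Sym v'Sym ZSym
    by (intro lyap_equation Sym_diff Sym_anticommutator) auto
  define E where "E s = Z s - Z t - (s - t) *\<^sub>R W" for s
  define D where "D s = c s - c t" for s
  define R where "R s = D s - (s - t) *\<^sub>R c'" for s
  define G where "G s = (v s - v t - (s - t) *\<^sub>R v') - (R s ** Z t + Z t ** R s)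
                        - (s - t) *\<^sub>R (D s ** W + W ** D s)" for s
  have lin: "((\<lambda>s. (s - t) *\<^sub>R (X::real^'n^'n)) has_vector_derivative X) (at t)" for X
    by (auto intro!: derivative_eq_intros)
  have D0: "D t = 0" "R t = 0" by (simp_all add: D_def R_def)
  have dD: "(D has_vector_derivative c') (at t)"
    unfolding D_def using has_vector_derivative_diff[OF c has_vector_derivative_const[of "c t"]] by simp
  have dR: "(R has_vector_derivative 0) (at t)"
    unfolding R_def using has_vector_derivative_diff[OF dD lin[of c']] by simp
  have d1: "((\<lambda>s. v s - v t - (s - t) *\<^sub>R v') has_vector_derivative 0) (at t)"
    using has_vector_derivative_diff[OF has_vector_derivative_diff[OF v has_vector_derivative_const[of "v t"]] lin[of v']]
    by simp
  have d2: "((\<lambda>s. R s ** Z t + Z t ** R s) has_vector_derivative 0) (at t)"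
    using has_vector_derivative_add[OF
        has_vector_derivative_matrix_mult[OF dR has_vector_derivative_const[of "Z t"]]
        has_vector_derivative_matrix_mult[OF has_vector_derivative_const[of "Z t"] dR]]
    by simp
  have "((\<lambda>s. D s ** W + W ** D s) has_vector_derivative (c' ** W + W ** c')) (at t)"
    using has_vector_derivative_add[OF
        has_vector_derivative_matrix_mult[OF dD has_vector_derivative_const[of W]]
        has_vector_derivative_matrix_mult[OF has_vector_derivative_const[of W] dD]]
    by simp
  moreover have "((\<lambda>s. s - t) has_field_derivative 1) (at t)"
    by (auto intro!: derivative_eq_intros)
  ultimately have d3: "((\<lambda>s. (s - t) *\<^sub>R (D s ** W + W ** D s)) has_vector_derivative 0) (at t)"
    using has_vector_derivative_scaleR[of "\<lambda>s. s - t" 1 t UNIV] D0 by fastforce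
  have dG: "(G has_vector_derivative 0) (at t)"
    unfolding G_def using has_vector_derivative_diff[OF has_vector_derivative_diff[OF d1 d2] d3] by simp
  have LE: "c s ** E s + E s ** c s = G s" if s: "s \<in> T" for s
  proof -
    have "c s ** E s + E s ** c s = (c s ** Z s + Z s ** c s) - (c t ** Z t + Z t ** c t)
       - (D s ** Z t + Z t ** D s) - (s - t) *\<^sub>R (c t ** W + W ** c t)
       - (s - t) *\<^sub>R (D s ** W + W ** D s)"
      by (simp add: E_def D_def matrix_distribs algebra_simps)
    also have "\<dots> = G s"
      unfolding Zeq[OF s] Zeq[OF T(2)] Weq G_def R_def
      by (simp add: matrix_distribs algebra_simps)
    finally show ?thesis .
  qed
  obtain m where m: "m > 0" "\<forall>\<^sub>F B in nhds (c t). \<forall>Z. m * norm Z \<le> norm (B ** Z + Z ** B)"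
    using lyapunov_norm_lower_near[OF T(3)[OF T(2)]] by blast
  have "(c \<longlongrightarrow> c t) (at t)"
    using has_vector_derivative_continuous[OF c] by (simp add: continuous_within)
  then have "\<forall>\<^sub>F s in at t. \<forall>Z. m * norm Z \<le> norm (c s ** Z + Z ** c s)"
    using m(2) by (rule eventually_compose_filterlim[rotated])
  moreover have "\<forall>\<^sub>F s in at t. s \<in> T"
    using T(1,2) by (simp add: eventually_at_in_open')
  ultimately have "\<forall>\<^sub>F s in at t. norm (E s) \<le> (1 / m) * norm (G s)"
  proof eventually_elim
    case (elim s)
    then have "m * norm (E s) \<le> norm (G s)" using LE[of s] by metis
    then show ?case using m(1) by (simp add: field_simps)
  qed
  moreover have "G t = 0" "E t = 0" by (simp_all add: G_def E_def D0)
  ultimately have "(E has_vector_derivative 0) (at t)"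
    using has_vector_derivative_0_by_comparison[OF dG] by blast
  then have "((\<lambda>s. E s + (s - t) *\<^sub>R W + Z t) has_vector_derivative W) (at t)"
    using has_vector_derivative_add[OF has_vector_derivative_add[OF _ lin[of W]] has_vector_derivative_const[of "Z t"]]
    by fastforce
  moreover have "(\<lambda>s. E s + (s - t) *\<^sub>R W + Z t) = Z" by (simp add: E_def fun_eq_iff)
  moreover have "(\<lambda>s. lyap (c s) (v s)) = Z" by (simp add: Z_def fun_eq_iff)
  ultimately show ?thesis by (simp add: W_def Z_def)
qed

section \<open>The Levi-Civita connection\<close>

text \<open>This bound makes the positive definite matrices open in the symmetric ones, as far as lines are
  concerned; directional derivatives at a point involve nothing else.\<close>
lemma Sym_quadratic_bound:
  fixes A :: "real^'n^'n"
  assumes "A \<in> Sym"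
  obtains C where "C > 0" "\<And>x. \<bar>x \<bullet> (A *v x)\<bar> \<le> C * (x \<bullet> x)"
proof
  let ?C = "\<bar>lam_min A\<bar> + \<bar>lam_max A\<bar> + 1"
  show "?C > 0" by linarith
  show "\<bar>x \<bullet> (A *v x)\<bar> \<le> ?C * (x \<bullet> x)" for x
  proof -
    have "lam_max A * (x \<bullet> x) \<le> ?C * (x \<bullet> x)" "- ?C * (x \<bullet> x) \<le> lam_min A * (x \<bullet> x)"
      by (intro mult_right_mono; simp)+
    then show ?thesis
      using lam_min_Sym(2)[OF assms, of x] lam_max_Sym(2)[OF assms, of x]
      unfolding abs_le_iff by linarith
  qed
qed

lemma SymPos_line:
  fixes A V :: "real^'n^'n"
  assumes A: "A \<in> SymPos" and V: "V \<in> Sym"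
  obtains e where "e > 0" "\<And>t. \<bar>t\<bar> < e \<Longrightarrow> A + t *\<^sub>R V \<in> SymPos"
proof -
  obtain m where m: "m > 0" "\<And>x. m * (x \<bullet> x) \<le> x \<bullet> (A *v x)"
    using SymPos_coercive[OF A] by blast
  obtain C where C: "C > 0" "\<And>x. \<bar>x \<bullet> (V *v x)\<bar> \<le> C * (x \<bullet> x)"
    using Sym_quadratic_bound[OF V] by blast
  have "A + t *\<^sub>R V \<in> SymPos" if t: "\<bar>t\<bar> < m / C" for t
  proof -
    have "0 < x \<bullet> ((A + t *\<^sub>R V) *v x)" if "x \<noteq> 0" for x
    proof -
      have "\<bar>t * (x \<bullet> (V *v x))\<bar> \<le> \<bar>t\<bar> * (C * (x \<bullet> x))"
        unfolding abs_mult by (intro mult_left_mono C) simp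
      also have "\<dots> = (\<bar>t\<bar> * C) * (x \<bullet> x)" by simp
      also have "\<dots> < m * (x \<bullet> x)"
        using t C(1) that by (intro mult_strict_right_mono) (simp_all add: field_simps)
      finally show ?thesis
        using m(2)[of x]
        by (simp add: matrix_vector_mult_add_rdistrib inner_add_right flip: scaleR_matrix_vector_assoc)
    qed
    then show ?thesis using A V SymPos_Sym by (simp add: SymPos_def Sym_intros)
  qed
  then show thesis using that[of "m / C"] m(1) C(1) by simp
qed

lemma trace_reverse3:
  fixes A B C :: "real^'n^'n"
  assumes "A \<in> Sym" "B \<in> Sym" "C \<in> Sym"
  shows "trace (A ** B ** C) = trace (C ** B ** A)"
  using trace_transpose[of "A ** B ** C"] assms[THEN SymD]
  by (simp add: matrix_transpose_mul matrix_mul_assoc)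

lemma trace_reverse4:
  fixes A B C D :: "real^'n^'n"
  assumes "A \<in> Sym" "B \<in> Sym" "C \<in> Sym" "D \<in> Sym"
  shows "trace (A ** B ** C ** D) = trace (D ** C ** B ** A)"
  using trace_transpose[of "A ** B ** C ** D"] assms[THEN SymD]
  by (simp add: matrix_transpose_mul matrix_mul_assoc)

text \<open>In this form one of the two applications of \<open>lyap\<close> has disappeared, which makes the terms in the
  derivative of the metric comparable.\<close>
lemma bw_metric_eq_left:
  fixes A V W :: "real^'n^'n"
  assumes "A \<in> SymPos" "V \<in> Sym" "W \<in> Sym"
  shows "bw_metric A V W = trace (lyap A V ** W) / 2"
proof -
  let ?X = "lyap A V" and ?Y = "lyap A W"
  note sym = lyap_Sym[OF assms(1,2)] lyap_Sym[OF assms(1,3)] SymPos_Sym[OF assms(1)]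
  have "trace (?X ** W) = trace (?X ** A ** ?Y) + trace (?X ** ?Y ** A)"
    using lyap_equation[OF assms(1,3)] by (metis matrix_add_ldistrib matrix_mul_assoc trace_add)
  also have "trace (?X ** ?Y ** A) = trace (A ** ?Y ** ?X)"
    by (rule trace_reverse3) (use sym in auto)
  also have "\<dots> = trace (?X ** A ** ?Y)"
    using trace_mul_sym[of ?X "A ** ?Y"] by (simp add: matrix_mul_assoc)
  finally show ?thesis by (simp add: bw_metric_def)
qed

lemma bw_metric_commute:
  fixes A V W :: "real^'n^'n"
  assumes "A \<in> SymPos" "V \<in> Sym" "W \<in> Sym"
  shows "bw_metric A V W = bw_metric A W V"
  unfolding bw_metric_def
  by (rule trace_reverse3) (use assms in \<open>auto intro: lyap_Sym SymPos_Sym\<close>)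

lemma bw_metric_eq_right:
  fixes A V W :: "real^'n^'n"
  assumes "A \<in> SymPos" "V \<in> Sym" "W \<in> Sym"
  shows "bw_metric A V W = trace (V ** lyap A W) / 2"
  using bw_metric_eq_left[OF assms(1,3,2)] bw_metric_commute[OF assms]
  by (simp add: trace_mul_sym[of V])

lemma bw_metric_definite:
  fixes A V :: "real^'n^'n"
  assumes "A \<in> SymPos" "V \<in> Sym" "bw_metric A V V = 0"
  shows "V = 0"
proof -
  obtain m where m: "m > 0" "\<And>x. m * (x \<bullet> x) \<le> x \<bullet> (A *v x)"
    using SymPos_coercive[OF assms(1)] by blast
  let ?Z = "lyap A V"
  have "m * (?Z \<bullet> ?Z) \<le> 0"
    using trace_sandwich_lower[OF m(2), of ?Z] assms(3) SymD[OF lyap_Sym[OF assms(1,2)]]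
    by (simp add: bw_metric_def)
  then have "?Z = 0" using m(1) by (simp add: mult_le_0_iff) (metis inner_gt_zero_iff not_less)
  then show ?thesis using lyap_equation[OF assms(1,2)] by simp
qed

text \<open>The sign and shape are those for which \<open>\<Sigma>'' = 2 Z \<Sigma> Z\<close> is the geodesic equation.\<close>
definition bw_christoffel :: "real^'n^'n \<Rightarrow> real^'n^'n \<Rightarrow> real^'n^'n \<Rightarrow> real^'n^'n" where
  "bw_christoffel A U V = - (lyap A U ** A ** lyap A V + lyap A V ** A ** lyap A U)"

lemma bw_christoffel_commute: "bw_christoffel A U V = bw_christoffel A V U"
  by (simp add: bw_christoffel_def)

lemma bw_christoffel_Sym:
  assumes "A \<in> SymPos" "U \<in> Sym" "V \<in> Sym"
  shows "bw_christoffel A U V \<in> Sym"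
  using lyap_Sym[OF assms(1,2), THEN SymD] lyap_Sym[OF assms(1,3), THEN SymD]
    SymD[OF SymPos_Sym[OF assms(1)]]
  by (simp add: bw_christoffel_def Sym_def transpose_linear_simps matrix_mul_assoc)

lemma christoffel_bw_christoffel: "bw.christoffel bw_christoffel"
  unfolding bw.christoffel_def
proof (intro conjI ballI allI)
  fix p u v w :: "real^'n^'n" and a b :: real
  assume *: "p \<in> SymPos" "u \<in> Sym" "v \<in> Sym" "w \<in> Sym"
  show "bw_christoffel p (a *\<^sub>R u + b *\<^sub>R v) w = a *\<^sub>R bw_christoffel p u w + b *\<^sub>R bw_christoffel p v w"
    using * by (simp add: bw_christoffel_def lyap_linear_combination matrix_distribs algebra_simps)
  show "bw_christoffel p w (a *\<^sub>R u + b *\<^sub>R v) = a *\<^sub>R bw_christoffel p w u + b *\<^sub>R bw_christoffel p w v"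
    using * by (simp add: bw_christoffel_def lyap_linear_combination matrix_distribs algebra_simps)
qed (rule bw_christoffel_Sym)

lemma torsion_free_bw_christoffel: "bw.torsion_free bw_christoffel"
  by (simp add: bw.torsion_free_def bw.nabla_def bw.lie_bracket_def bw_christoffel_commute)

lemma vector_field_along_line:
  fixes Y :: "real^'n^'n \<Rightarrow> real^'n^'n"
  assumes Y: "Y \<in> bw.vector_fields" and p: "p \<in> SymPos" and u: "u \<in> Sym"
  obtains D where "((\<lambda>t. Y (p + t *\<^sub>R u)) has_vector_derivative D) (at 0)"
proof -
  obtain e where e: "e > 0" "\<And>t. \<bar>t\<bar> < e \<Longrightarrow> p + t *\<^sub>R u \<in> SymPos"
    using SymPos_line[OF p u] by blast
  let ?T = "{- e <..< e}" and ?c = "\<lambda>t. p + t *\<^sub>R u"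
  have cT: "?c ` ?T \<subseteq> SymPos" using e(2) by (auto simp: abs_less_iff)
  obtain Y' where "(Y has_derivative Y') (at p within SymPos)"
    using Y p by (auto simp: bw.vector_fields_def differentiable_on_def differentiable_def)
  then have "(Y has_derivative Y') (at (?c 0) within ?c ` ?T)"
    using has_derivative_subset[OF _ cT] by simp
  moreover have "(?c has_vector_derivative u) (at 0 within ?T)"
    by (auto intro!: derivative_eq_intros)
  ultimately have "((Y \<circ> ?c) has_vector_derivative Y' u) (at 0 within ?T)"
    using vector_derivative_diff_chain_within by blast
  moreover have "at 0 within ?T = at 0" using e(1) by (intro at_within_open) auto
  ultimately have "((\<lambda>t. Y (?c t)) has_vector_derivative Y' u) (at 0)"
    by (simp only: o_def)
  then show thesis by (rule that)
qed

text \<open>Along the line \<open>p + t u\<close> put \<open>A = lyap p Y\<close>, \<open>B = lyap p Z\<close> and \<open>u = p C + C p\<close>. The derivative of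
  \<open>tr (A c B)\<close> is then a sum of traces of products of \<open>A\<close>, \<open>B\<close>, \<open>C\<close>, \<open>p\<close>, and it agrees with the
  right-hand side because traces are invariant under cyclic shifts and, for symmetric factors, under
  reversal.\<close>
lemma metric_compatible_bw_christoffel: "bw.metric_compatible bw_christoffel"
  unfolding bw.metric_compatible_def
proof (intro ballI)
  fix X Y Z :: "real^'n^'n \<Rightarrow> real^'n^'n" and p :: "real^'n^'n"
  assume X: "X \<in> bw.vector_fields" and Y: "Y \<in> bw.vector_fields" and Z: "Z \<in> bw.vector_fields"
    and p: "p \<in> SymPos"
  have val: "F q \<in> Sym" if "F \<in> bw.vector_fields" "q \<in> SymPos" for F and q :: "real^'n^'n"
    using that by (simp add: bw.vector_fields_def)
  define u where "u = X p"
  have u: "u \<in> Sym" using val[OF X p] by (simp add: u_def)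
  obtain e where e: "e > 0" "\<And>t. \<bar>t\<bar> < e \<Longrightarrow> p + t *\<^sub>R u \<in> SymPos"
    using SymPos_line[OF p u] by blast
  let ?T = "{- e <..< e}"
  define c where "c t = p + t *\<^sub>R u" for t
  have cT: "c t \<in> SymPos" if "t \<in> ?T" for t
    using e(2) that by (auto simp: abs_less_iff c_def)
  have T: "open ?T" "0 \<in> ?T" using e(1) by auto
  have dc: "(c has_vector_derivative u) (at 0)"
    unfolding c_def by (auto intro!: derivative_eq_intros)
  have c0: "c 0 = p" by (simp add: c_def)
  obtain DY where DY: "((\<lambda>t. Y (c t)) has_vector_derivative DY) (at 0)"
    using vector_field_along_line[OF Y p u] unfolding c_def .
  obtain DZ where DZ: "((\<lambda>t. Z (c t)) has_vector_derivative DZ) (at 0)"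
    using vector_field_along_line[OF Z p u] unfolding c_def .
  have DYs: "DY \<in> Sym" using Sym_vector_derivative[OF DY T] val[OF Y] cT by blast
  have DZs: "DZ \<in> Sym" using Sym_vector_derivative[OF DZ T] val[OF Z] cT by blast
  define A where "A = lyap p (Y p)"
  define B where "B = lyap p (Z p)"
  define C where "C = lyap p u"
  define VY where "VY = DY - (u ** A + A ** u)"
  define VZ where "VZ = DZ - (u ** B + B ** u)"
  note Ys = val[OF Y p] and Zs = val[OF Z p]
  have s: "A \<in> Sym" "B \<in> Sym" "C \<in> Sym" "p \<in> Sym"
    using lyap_Sym[OF p] Ys Zs u SymPos_Sym[OF p] by (auto simp: A_def B_def C_def)
  have Vs: "VY \<in> Sym" "VZ \<in> Sym"
    unfolding VY_def VZ_def using s u DYs DZs by (auto intro!: Sym_diff Sym_anticommutator)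
  have ueq: "u = p ** C + C ** p" unfolding C_def using lyap_equation[OF p u] by simp
  have dA: "((\<lambda>t. lyap (c t) (Y (c t))) has_vector_derivative lyap p VY) (at 0)"
    using has_vector_derivative_lyap[OF dc DY T cT] val[OF Y] cT by (simp add: c0 A_def VY_def)
  have dB: "((\<lambda>t. lyap (c t) (Z (c t))) has_vector_derivative lyap p VZ) (at 0)"
    using has_vector_derivative_lyap[OF dc DZ T cT] val[OF Z] cT by (simp add: c0 B_def VZ_def)
  have "((\<lambda>t. bw_metric (c t) (Y (c t)) (Z (c t))) has_vector_derivative
      trace (A ** p ** lyap p VZ + (A ** u + lyap p VY ** p) ** B)) (at 0)"
    unfolding bw_metric_def
    using has_vector_derivative_trace[OF has_vector_derivative_matrix_mult[OF has_vector_derivative_matrix_mult[OF dA dc] dB]]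
    by (simp add: c0 A_def B_def)
  then have L: "dirderiv (\<lambda>q. bw_metric q (Y q) (Z q)) p (X p) =
      trace (A ** p ** lyap p VZ) + trace (A ** u ** B) + trace (lyap p VY ** p ** B)"
    unfolding dirderiv_def u_def[symmetric] c_def[symmetric]
    by (simp add: vector_derivative_at matrix_distribs trace_linear_simps)
  have M1: "trace (A ** p ** lyap p VZ) = trace (A ** VZ) / 2"
    using bw_metric_eq_left[OF p Ys Vs(2)] by (simp add: bw_metric_def A_def)
  have M2: "trace (lyap p VY ** p ** B) = trace (VY ** B) / 2"
    using bw_metric_eq_right[OF p Vs(1) Zs] by (simp add: bw_metric_def B_def)
  have N1: "bw.nabla bw_christoffel X Y p = DY - (C ** p ** A + A ** p ** C)"
    unfolding bw.nabla_def dirderiv_def u_def[symmetric] c_def[symmetric]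
    by (simp add: vector_derivative_at[OF DY] bw_christoffel_def A_def C_def)
  have N2: "bw.nabla bw_christoffel X Z p = DZ - (C ** p ** B + B ** p ** C)"
    unfolding bw.nabla_def dirderiv_def u_def[symmetric] c_def[symmetric]
    by (simp add: vector_derivative_at[OF DZ] bw_christoffel_def B_def C_def)
  have S: "DY - (C ** p ** A + A ** p ** C) \<in> Sym" "DZ - (C ** p ** B + B ** p ** C) \<in> Sym"
    using Sym_add[OF DYs bw_christoffel_Sym[OF p u Ys]] Sym_add[OF DZs bw_christoffel_Sym[OF p u Zs]]
    unfolding bw_christoffel_def A_def[symmetric] B_def[symmetric] C_def[symmetric]
      add_uminus_conv_diff by auto
  have "trace (VY ** B) / 2 + trace (A ** u ** B) + trace (A ** VZ) / 2 =
     trace ((DY - (C ** p ** A + A ** p ** C)) ** B) / 2 + trace (A ** (DZ - (C ** p ** B + B ** p ** C))) / 2"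
  proof -
    have 1: "trace (A ** p ** C ** B) = trace (A ** B ** C ** p)"
      using trace_reverse4[of A p C B] trace_mul_sym[of A "B ** C ** p"] s by (simp add: matrix_mul_assoc)
    have 2: "trace (A ** C ** p ** B) = trace (p ** C ** A ** B)"
      using trace_reverse4[of A C p B] trace_mul_sym[of B "p ** C ** A"] s by (simp add: matrix_mul_assoc)
    show ?thesis
      unfolding VY_def VZ_def ueq using 1 2
      by (simp add: matrix_distribs trace_linear_simps field_simps)
  qed
  then show "dirderiv (\<lambda>q. bw_metric q (Y q) (Z q)) p (X p) =
      bw_metric p (bw.nabla bw_christoffel X Y p) (Z p) + bw_metric p (Y p) (bw.nabla bw_christoffel X Z p)"
    unfolding L N1 N2 M1 M2 bw_metric_eq_right[OF p S(1) Zs] bw_metric_eq_left[OF p Ys S(2)]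
    unfolding A_def[symmetric] B_def[symmetric] by linarith
qed

text \<open>Koszul's argument on constant vector fields: the difference of two torsion-free metric connections
  is symmetric in its first two arguments and, after pairing, antisymmetric in its last two, so it
  vanishes because the metric is definite. Thus the choice in the definition of \<open>levi_civita\<close> is
  immaterial on the manifold.\<close>
theorem levi_civita_eq_bw_christoffel:
  fixes p u :: "real^'n^'n"
  assumes p: "p \<in> SymPos" and u: "u \<in> Sym" and v: "v \<in> Sym"
  shows "bw.levi_civita p u v = bw_christoffel p u v"
proof -
  define G :: "real^'n^'n \<Rightarrow> real^'n^'n \<Rightarrow> real^'n^'n \<Rightarrow> real^'n^'n" where "G = bw.levi_civita"
  have "bw.christoffel G \<and> bw.torsion_free G \<and> bw.metric_compatible G"
    unfolding G_def bw.levi_civita_def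
    by (rule someI[of _ bw_christoffel])
       (simp add: christoffel_bw_christoffel torsion_free_bw_christoffel metric_compatible_bw_christoffel)
  then have G: "bw.christoffel G" "bw.torsion_free G" "bw.metric_compatible G" by auto
  have const: "(\<lambda>_. w) \<in> bw.vector_fields" if "w \<in> Sym" for w :: "real^'n^'n"
    using that by (simp add: bw.vector_fields_def)
  have nab: "bw.nabla H (\<lambda>_. a) (\<lambda>_. b) p = H p a b" for H and a b :: "real^'n^'n"
    by (simp add: bw.nabla_def dirderiv_def)
  have com: "H p a b = H p b a" if "bw.torsion_free H" "a \<in> Sym" "b \<in> Sym" for H a b
    using that(1)[unfolded bw.torsion_free_def, rule_format, OF const[OF that(2)] const[OF that(3)] p]
    by (simp add: nab bw.lie_bracket_def dirderiv_def)
  have comp: "bw_metric p (G p a b) c + bw_metric p b (G p a c) =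
      bw_metric p (bw_christoffel p a b) c + bw_metric p b (bw_christoffel p a c)"
    if s: "a \<in> Sym" "b \<in> Sym" "c \<in> Sym" for a b c
    using G(3)[unfolded bw.metric_compatible_def, rule_format, OF s[THEN const] p]
      metric_compatible_bw_christoffel[unfolded bw.metric_compatible_def, rule_format, OF s[THEN const] p]
    by (simp add: nab)
  have GS: "G p a b \<in> Sym" if "a \<in> Sym" "b \<in> Sym" for a b
    using G(1) that p by (simp add: bw.christoffel_def)
  define d where "d a b = G p a b - bw_christoffel p a b" for a b
  have dS: "d a b \<in> Sym" if "a \<in> Sym" "b \<in> Sym" for a b
    unfolding d_def by (intro Sym_diff GS bw_christoffel_Sym p that)
  have dcom: "d a b = d b a" if "a \<in> Sym" "b \<in> Sym" for a b
    using com[OF G(2) that] by (simp add: d_def bw_christoffel_commute)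
  have anti: "bw_metric p (d a b) c = - bw_metric p (d a c) b"
    if s: "a \<in> Sym" "b \<in> Sym" "c \<in> Sym" for a b c
  proof -
    have sub: "bw_metric p (d a b) c = bw_metric p (G p a b) c - bw_metric p (bw_christoffel p a b) c"
      if "a \<in> Sym" "b \<in> Sym" "c \<in> Sym" for a b c
      using that p dS[of a b]
      by (simp add: bw_metric_eq_right GS bw_christoffel_Sym d_def matrix_distribs trace_linear_simps diff_divide_distrib)
    show ?thesis
      using comp[OF s] sub[OF s] sub[of a c b] s bw_metric_commute[OF p, of b]
      by (simp add: GS bw_christoffel_Sym p)
  qed
  let ?w = "d u v"
  note w = dS[OF u v]
  have "bw_metric p (d u v) ?w = - bw_metric p (d u v) ?w"
    using anti[OF u v w] anti[OF w u v] anti[OF v w u] dcom[OF u v] dcom[OF u w] dcom[OF v w] by simp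
  then have "?w = 0" using bw_metric_definite[OF p w] by simp
  then show ?thesis by (simp add: d_def G_def)
qed

section \<open>Geodesics\<close>

text \<open>The squared norm \<open>q\<close> of \<open>f\<close> satisfies \<open>|q'| \<le> 2 M q\<close> on the compact segment between \<open>0\<close> and \<open>t\<close>,
  so \<open>q s * exp (- 2 M s)\<close> does not increase to the right of \<open>0\<close> and \<open>q s * exp (2 M s)\<close> does not
  decrease to the left of \<open>0\<close>.\<close>
lemma gronwall_zero:
  fixes f :: "real \<Rightarrow> 'a::real_inner"
  assumes J: "is_interval J" "0 \<in> J"
    and f: "\<And>t. t \<in> J \<Longrightarrow> (f has_vector_derivative f' t) (at t)" "f 0 = 0"
    and k: "continuous_on J k" "\<And>t. t \<in> J \<Longrightarrow> norm (f' t) \<le> k t * norm (f t)"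
    and t: "t \<in> J"
  shows "f t = 0"
proof -
  let ?C = "{min 0 t..max 0 t}"
  have CJ: "?C \<subseteq> J"
  proof
    fix s assume s: "s \<in> ?C"
    have "min 0 t \<in> J" "max 0 t \<in> J" using J(2) t by (simp_all add: min_def max_def)
    from mem_is_interval_1_I[OF J(1) this] show "s \<in> J" using s by simp
  qed
  have "compact (k ` ?C)"
    using continuous_on_subset[OF k(1) CJ] by (intro compact_continuous_image) auto
  then have "bounded (k ` ?C)" by (rule compact_imp_bounded)
  then obtain M where M: "\<forall>y\<in>k ` ?C. norm y \<le> M"
    unfolding bounded_iff by (rule exE)
  define q where "q s = f s \<bullet> f s" for s
  define q' where "q' s = 2 * (f s \<bullet> f' s)" for s
  have q0: "q 0 = 0" "q s \<ge> 0" for s using f(2) by (simp_all add: q_def)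
  have dq: "(q has_real_derivative q' s) (at s)" if "s \<in> ?C" for s
  proof -
    have "((\<lambda>s. f s \<bullet> f s) has_vector_derivative (f s \<bullet> f' s + f' s \<bullet> f s)) (at s)"
      using f(1) CJ that by (intro bounded_bilinear.has_vector_derivative[OF bounded_bilinear_inner]) auto
    then show ?thesis
      by (simp add: q_def[abs_def] q'_def has_real_derivative_iff_has_vector_derivative inner_commute)
  qed
  have bound: "\<bar>q' s\<bar> \<le> 2 * M * q s" if s: "s \<in> ?C" for s
  proof -
    have "\<bar>f s \<bullet> f' s\<bar> \<le> norm (f s) * norm (f' s)" by (rule Cauchy_Schwarz_ineq2)
    also have "\<dots> \<le> norm (f s) * (M * norm (f s))"
    proof (intro mult_left_mono norm_ge_zero)
      have "norm (f' s) \<le> k s * norm (f s)" using k(2) CJ s by blast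
      also have "\<dots> \<le> M * norm (f s)"
      proof (rule mult_right_mono)
        have "norm (k s) \<le> M" by (rule bspec[OF M imageI[OF s]])
        then show "k s \<le> M" by (simp add: abs_le_iff)
      qed simp
      finally show "norm (f' s) \<le> M * norm (f s)" .
    qed
    also have "\<dots> = M * q s" by (simp add: q_def dot_square_norm power2_eq_square)
    finally show ?thesis by (simp add: q'_def abs_mult)
  qed
  have "q t \<le> 0"
  proof (cases "0 \<le> t")
    case True
    define h where "h s = q s * exp (- (2 * M) * s)" for s
    have "h t \<le> h 0"
    proof (rule DERIV_nonpos_imp_nonincreasing[OF True])
      fix s assume "0 \<le> s" "s \<le> t"
      then have s: "s \<in> ?C" by auto
      have "(h has_real_derivative (q' s - 2 * M * q s) * exp (- (2 * M) * s)) (at s)"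
        unfolding h_def[abs_def]
        by (auto intro!: derivative_eq_intros dq[OF s] simp: algebra_simps)
      moreover have "(q' s - 2 * M * q s) * exp (- (2 * M) * s) \<le> 0"
        using bound[OF s] by (intro mult_nonpos_nonneg) auto
      ultimately show "\<exists>y. DERIV h s :> y \<and> y \<le> 0" by blast
    qed
    then show ?thesis by (simp add: h_def q0 mult_le_0_iff)
  next
    case False
    define h where "h s = q s * exp (2 * M * s)" for s
    have t0: "t \<le> 0" using False by simp
    have "h t \<le> h 0"
    proof (rule DERIV_nonneg_imp_nondecreasing[OF t0])
      fix s assume "t \<le> s" "s \<le> 0"
      then have s: "s \<in> ?C" by auto
      have "(h has_real_derivative (q' s + 2 * M * q s) * exp (2 * M * s)) (at s)"
        unfolding h_def[abs_def]
        by (auto intro!: derivative_eq_intros dq[OF s] simp: algebra_simps)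
      moreover have "0 \<le> (q' s + 2 * M * q s) * exp (2 * M * s)"
        using bound[OF s] by (intro mult_nonneg_nonneg) auto
      ultimately show "\<exists>y. DERIV h s :> y \<and> 0 \<le> y" by blast
    qed
    then show ?thesis by (simp add: h_def q0 mult_le_0_iff)
  qed
  with q0(2)[of t] have "q t = 0" by simp
  then show ?thesis by (simp add: q_def)
qed

definition bw_interval :: "real^'n^'n \<Rightarrow> real set" where
  "bw_interval S = {t. mat 1 + t *\<^sub>R S \<in> SymPos}"

definition bw_curve :: "real^'n^'n \<Rightarrow> real^'n^'n \<Rightarrow> real \<Rightarrow> real^'n^'n" where
  "bw_curve A S t = (mat 1 + t *\<^sub>R S) ** A ** (mat 1 + t *\<^sub>R S)"

lemma bw_curve_0 [simp]: "bw_curve A S 0 = A"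
  by (simp add: bw_curve_def)

lemma bw_curve_expand:
  "bw_curve A S t = A + t *\<^sub>R (A ** S + S ** A) + t\<^sup>2 *\<^sub>R (S ** A ** S)"
  by (simp add: bw_curve_def matrix_distribs scaleR_add_right power2_eq_square)

lemma zero_in_bw_interval: "0 \<in> bw_interval S"
  by (simp add: bw_interval_def mat_1_SymPos)

lemma eigenvector_shift:
  fixes S :: "real^'n^'n"
  assumes "S *v x = l *\<^sub>R x"
  shows "(mat 1 + t *\<^sub>R S) *v x = (1 + t * l) *\<^sub>R x"
  by (simp add: matrix_vector_mult_add_rdistrib assms scaleR_add_left flip: scaleR_matrix_vector_assoc)

text \<open>The quadratic form of \<open>1 + t S\<close> is bounded below by \<open>1 + t * lam_min S\<close> for \<open>t \<ge> 0\<close> and by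
  \<open>1 + t * lam_max S\<close> for \<open>t \<le> 0\<close>, and eigenvectors attain these values.\<close>
lemma bw_interval_iff:
  fixes S :: "real^'n^'n"
  assumes S: "S \<in> Sym"
  shows "t \<in> bw_interval S \<longleftrightarrow> 0 < 1 + t * lam_min S \<and> 0 < 1 + t * lam_max S"
proof
  assume t: "t \<in> bw_interval S"
  have "0 < 1 + t * l" if l: "l \<in> eigenvals S" for l
  proof -
    obtain x where x: "x \<noteq> 0" "S *v x = l *\<^sub>R x" using l by (auto simp: eigenvals_def)
    have "0 < x \<bullet> ((mat 1 + t *\<^sub>R S) *v x)"
      using t x(1) by (intro SymPosD) (simp_all add: bw_interval_def)
    then have "0 < (1 + t * l) * (x \<bullet> x)"
      by (simp add: eigenvector_shift[OF x(2)])
    then show ?thesis by (rule zero_less_mult_pos2) (simp add: x(1))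
  qed
  then show "0 < 1 + t * lam_min S \<and> 0 < 1 + t * lam_max S"
    using lam_min_Sym(1)[OF S] lam_max_Sym(1)[OF S] by blast
next
  assume pos: "0 < 1 + t * lam_min S \<and> 0 < 1 + t * lam_max S"
  have "0 < x \<bullet> ((mat 1 + t *\<^sub>R S) *v x)" if x: "x \<noteq> 0" for x
  proof -
    have e: "x \<bullet> ((mat 1 + t *\<^sub>R S) *v x) = x \<bullet> x + t * (x \<bullet> (S *v x))"
      by (simp add: matrix_vector_mult_add_rdistrib inner_add_right flip: scaleR_matrix_vector_assoc)
    have xx: "0 < x \<bullet> x" using x by simp
    have "\<exists>l. 0 < 1 + t * l \<and> t * (l * (x \<bullet> x)) \<le> t * (x \<bullet> (S *v x))"
    proof (cases "0 \<le> t")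
      case True
      then show ?thesis using pos lam_min_Sym(2)[OF S, of x] by (blast intro: mult_left_mono)
    next
      case False
      then have "t * (lam_max S * (x \<bullet> x)) \<le> t * (x \<bullet> (S *v x))"
        using lam_max_Sym(2)[OF S, of x] by (intro mult_left_mono_neg) auto
      then show ?thesis using pos by blast
    qed
    then obtain l where l: "0 < 1 + t * l" "t * (l * (x \<bullet> x)) \<le> t * (x \<bullet> (S *v x))" by blast
    have "0 < (1 + t * l) * (x \<bullet> x)" using l(1) xx by (rule mult_pos_pos)
    then show ?thesis unfolding e using l(2) by (simp add: algebra_simps)
  qed
  then show "t \<in> bw_interval S"
    using S by (simp add: bw_interval_def SymPos_def Sym_intros)
qed

lemma bw_interval_as_Int:
  fixes S :: "real^'n^'n"
  assumes "S \<in> Sym"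
  shows "bw_interval S = {t. 0 < 1 + t * lam_min S} \<inter> {t. 0 < 1 + t * lam_max S}"
  using bw_interval_iff[OF assms] by auto

lemma open_bw_interval:
  fixes S :: "real^'n^'n"
  assumes "S \<in> Sym"
  shows "open (bw_interval S)"
  unfolding bw_interval_as_Int[OF assms]
  by (intro open_Int open_Collect_less continuous_intros)

lemma is_interval_positive_affine: "is_interval {t::real. 0 < 1 + t * l}"
  unfolding is_interval_1
proof (intro ballI allI impI)
  fix a b x assume a: "a \<in> {t. 0 < 1 + t * l}" and b: "b \<in> {t. 0 < 1 + t * l}" and x: "a \<le> x \<and> x \<le> b"
  have "a * l \<le> x * l \<or> b * l \<le> x * l"
    using x by (cases "0 \<le> l") (auto intro: mult_right_mono mult_right_mono_neg)
  then show "x \<in> {t. 0 < 1 + t * l}" using a b by auto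
qed

lemma is_interval_bw_interval:
  fixes S :: "real^'n^'n"
  assumes "S \<in> Sym"
  shows "is_interval (bw_interval S)"
  unfolding bw_interval_as_Int[OF assms]
  by (intro is_interval_Int is_interval_positive_affine)

lemma bw_curve_SymPos:
  fixes A S :: "real^'n^'n"
  assumes "A \<in> SymPos" "t \<in> bw_interval S"
  shows "bw_curve A S t \<in> SymPos"
  using assms SymPos_Sym SymPos_ker unfolding bw_curve_def bw_interval_def
  by (intro SymPos_sandwich) auto

text \<open>The Lyapunov coordinate \<open>lyap \<Sigma>(t) \<Sigma>'(t)\<close> of the velocity of \<open>bw_curve \<Sigma> S\<close>; it depends on \<open>S\<close>
  alone.\<close>
definition bw_velocity :: "real^'n^'n \<Rightarrow> real \<Rightarrow> real^'n^'n" where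
  "bw_velocity S t = matrix_inv (mat 1 + t *\<^sub>R S) ** S"

lemma
  fixes S :: "real^'n^'n"
  assumes S: "S \<in> Sym" and t: "t \<in> bw_interval S"
  shows bw_velocity_left: "(mat 1 + t *\<^sub>R S) ** bw_velocity S t = S"
    and bw_velocity_right: "bw_velocity S t ** (mat 1 + t *\<^sub>R S) = S"
    and bw_velocity_Sym: "bw_velocity S t \<in> Sym"
proof -
  define P where "P = mat 1 + t *\<^sub>R S"
  define Q where "Q = matrix_inv P"
  have "P \<in> SymPos" using t by (simp add: bw_interval_def P_def)
  from SymPos_matrix_inv[OF this] have Q: "Q ** P = mat 1" "P ** Q = mat 1" "Q \<in> Sym"
    by (simp_all add: Q_def)
  have Z: "bw_velocity S t = Q ** S" by (simp add: bw_velocity_def Q_def P_def)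
  have com: "S ** P = P ** S" by (simp add: P_def matrix_distribs)
  show 1: "(mat 1 + t *\<^sub>R S) ** bw_velocity S t = S"
    unfolding P_def[symmetric] Z by (simp add: matrix_mul_assoc Q)
  have "Q ** S ** P = Q ** P ** S" using com by (simp flip: matrix_mul_assoc)
  then show 2: "bw_velocity S t ** (mat 1 + t *\<^sub>R S) = S"
    unfolding P_def[symmetric] Z by (simp add: Q)
  have "S ** Q = Q ** S ** P ** Q" using 2 unfolding P_def[symmetric] Z by simp
  also have "\<dots> = Q ** S" using Q by (simp flip: matrix_mul_assoc)
  finally show "bw_velocity S t \<in> Sym"
    using S Q(3) by (simp add: Z Sym_def matrix_transpose_mul)
qed

lemma has_vector_derivative_shift:
  "((\<lambda>t. mat 1 + t *\<^sub>R S) has_vector_derivative S) (at t)" for S :: "real^'n^'n"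
  by (auto intro!: derivative_eq_intros)

text \<open>With \<open>P = 1 + t S\<close>, the matrix \<open>Z\<close> is also the solution of \<open>P Z + Z P = 2 S\<close>, so the derivative
  of \<open>lyap\<close> along \<open>P\<close> applies to it.\<close>
lemma bw_velocity_riccati:
  fixes S :: "real^'n^'n"
  assumes S: "S \<in> Sym" and t: "t \<in> bw_interval S"
  shows "(bw_velocity S has_vector_derivative - (bw_velocity S t ** bw_velocity S t)) (at t)"
proof -
  let ?P = "\<lambda>t. mat 1 + t *\<^sub>R S"
  have Z: "lyap (?P s) (2 *\<^sub>R S) = bw_velocity S s" if "s \<in> bw_interval S" for s
    using that S by (intro lyap_eqI bw_velocity_Sym)
      (simp_all add: bw_interval_def bw_velocity_left bw_velocity_right scaleR_2)
  have "((\<lambda>s. lyap (?P s) (2 *\<^sub>R S)) has_vector_derivative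
      lyap (?P t) (0 - (S ** lyap (?P t) (2 *\<^sub>R S) + lyap (?P t) (2 *\<^sub>R S) ** S))) (at t)"
    by (rule has_vector_derivative_lyap[OF has_vector_derivative_shift has_vector_derivative_const
          open_bw_interval[OF S] t])
       (use S in \<open>auto simp: bw_interval_def Sym_scaleR\<close>)
  moreover have "lyap (?P t) (0 - (S ** bw_velocity S t + bw_velocity S t ** S)) =
      - (bw_velocity S t ** bw_velocity S t)"
  proof (rule lyap_eqI)
    let ?Z = "bw_velocity S t"
    show "?P t \<in> SymPos" using t by (simp add: bw_interval_def)
    show "- (?Z ** ?Z) \<in> Sym"
      using bw_velocity_Sym[OF S t] by (simp add: Sym_def transpose_linear_simps)
    have "?P t ** (- (?Z ** ?Z)) + - (?Z ** ?Z) ** ?P t = - (?P t ** ?Z ** ?Z + ?Z ** (?Z ** ?P t))"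
      by (simp add: matrix_mult.minus_left matrix_mult.minus_right matrix_mul_assoc)
    then show "?P t ** (- (?Z ** ?Z)) + - (?Z ** ?Z) ** ?P t = 0 - (S ** ?Z + ?Z ** S)"
      unfolding bw_velocity_left[OF S t] bw_velocity_right[OF S t] by simp
  qed
  ultimately have "((\<lambda>s. lyap (?P s) (2 *\<^sub>R S)) has_vector_derivative
      - (bw_velocity S t ** bw_velocity S t)) (at t)"
    by (simp add: Z[OF t])
  then show ?thesis
    by (rule has_vector_derivative_transform_within_open[OF _ open_bw_interval[OF S] t Z])
qed

lemma has_vector_derivative_bw_curve:
  fixes A S :: "real^'n^'n"
  shows "(bw_curve A S has_vector_derivative
      ((mat 1 + t *\<^sub>R S) ** A ** S + S ** A ** (mat 1 + t *\<^sub>R S))) (at t)"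
  unfolding bw_curve_def[abs_def]
  using has_vector_derivative_matrix_mult[OF has_vector_derivative_matrix_mult[OF
        has_vector_derivative_shift has_vector_derivative_const[of A]] has_vector_derivative_shift]
  by simp

lemma
  fixes A S :: "real^'n^'n"
  assumes A: "A \<in> SymPos" and S: "S \<in> Sym" and t: "t \<in> bw_interval S"
  shows lyap_bw_curve:
      "lyap (bw_curve A S t) ((mat 1 + t *\<^sub>R S) ** A ** S + S ** A ** (mat 1 + t *\<^sub>R S)) = bw_velocity S t"
    and bw_velocity_sandwich: "bw_velocity S t ** bw_curve A S t ** bw_velocity S t = S ** A ** S"
    and bw_curve_derivative_Sym:
      "(mat 1 + t *\<^sub>R S) ** A ** S + S ** A ** (mat 1 + t *\<^sub>R S) \<in> Sym"
proof -
  let ?P = "mat 1 + t *\<^sub>R S" and ?Z = "bw_velocity S t"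
  have c: "?P ** A ** ?P = bw_curve A S t" by (simp add: bw_curve_def)
  have 1: "bw_curve A S t ** ?Z = ?P ** A ** S"
    unfolding bw_curve_def matrix_mul_assoc[symmetric] bw_velocity_left[OF S t] ..
  have 2: "?Z ** bw_curve A S t = S ** A ** ?P"
    unfolding bw_curve_def matrix_mul_assoc bw_velocity_right[OF S t] ..
  show "lyap (bw_curve A S t) (?P ** A ** S + S ** A ** ?P) = ?Z"
    by (rule lyap_eqI[OF bw_curve_SymPos[OF A t] bw_velocity_Sym[OF S t]]) (simp add: 1 2)
  show "?Z ** bw_curve A S t ** ?Z = S ** A ** S"
    unfolding 2 unfolding matrix_mul_assoc[symmetric] bw_velocity_left[OF S t] ..
  show "?P ** A ** S + S ** A ** ?P \<in> Sym"
    unfolding 1[symmetric] 2[symmetric]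
    by (intro Sym_anticommutator SymPos_Sym bw_curve_SymPos A t bw_velocity_Sym S)
qed

lemma bw_christoffel_diag: "bw_christoffel A U U = - 2 *\<^sub>R (lyap A U ** A ** lyap A U)"
  by (simp add: bw_christoffel_def scaleR_2 scaleR_minus_left del: scaleR_minus_left)
     (simp add: scaleR_2)

lemma geodesic_bw_curve:
  fixes A S :: "real^'n^'n"
  assumes A: "A \<in> SymPos" and S: "S \<in> Sym"
  shows "bw.geodesic (bw_interval S) (bw_curve A S)"
  unfolding bw.geodesic_def
proof (intro conjI exI ballI)
  show "open (bw_interval S)" "is_interval (bw_interval S)"
    by (rule open_bw_interval[OF S] is_interval_bw_interval[OF S])+
  show "bw_curve A S ` bw_interval S \<subseteq> SymPos" using bw_curve_SymPos[OF A] by blast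
  let ?P = "\<lambda>t. mat 1 + t *\<^sub>R S"
  let ?c' = "\<lambda>t. ?P t ** A ** S + S ** A ** ?P t"
  fix t assume t: "t \<in> bw_interval S"
  show "(bw_curve A S has_vector_derivative ?c' t) (at t)" by (rule has_vector_derivative_bw_curve)
  have "?c' = (\<lambda>t. (A ** S + S ** A) + t *\<^sub>R (2 *\<^sub>R (S ** A ** S)))"
    by (simp add: fun_eq_iff matrix_distribs scaleR_2 scaleR_add_right)
  then show "(?c' has_vector_derivative 2 *\<^sub>R (S ** A ** S)) (at t)"
    by (auto intro!: derivative_eq_intros)
  show "2 *\<^sub>R (S ** A ** S) + bw.levi_civita (bw_curve A S t) (?c' t) (?c' t) = 0"
    unfolding levi_civita_eq_bw_christoffel[OF bw_curve_SymPos[OF A t]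
        bw_curve_derivative_Sym[OF A S t] bw_curve_derivative_Sym[OF A S t]]
      bw_christoffel_diag lyap_bw_curve[OF A S t] bw_velocity_sandwich[OF A S t] by simp
qed

text \<open>For a geodesic \<open>b\<close> with \<open>Z = lyap b b'\<close> and \<open>P = 1 + t S\<close>, the Riccati equation makes
  \<open>D = P Z - S\<close> a solution of \<open>D' = - D Z\<close>, and once \<open>P Z = S\<close> is known, the difference \<open>D\<close> of \<open>b\<close> and
  \<open>P \<Sigma> P\<close> satisfies \<open>D' = D Z + Z D\<close>. Both start at \<open>0\<close>. If \<open>J\<close> contained a time at which \<open>P\<close> is not
  positive definite, it would contain one at which \<open>P\<close> kills an eigenvector \<open>x\<close> of \<open>S\<close>, and there
  \<open>x\<close> would be in the kernel of \<open>b\<close>.\<close>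
theorem geodesic_from_unique:
  fixes A V :: "real^'n^'n"
  assumes A: "A \<in> SymPos" and V: "V \<in> Sym" and b: "bw.geodesic_from A V J b"
  defines "S \<equiv> lyap A V"
  shows "J \<subseteq> bw_interval S" and "\<And>t. t \<in> J \<Longrightarrow> b t = bw_curve A S t"
proof -
  have S: "S \<in> Sym" unfolding S_def by (rule lyap_Sym[OF A V])
  from b obtain b' b'' where J: "open J" "is_interval J" "0 \<in> J" and bpos: "\<And>t. t \<in> J \<Longrightarrow> b t \<in> SymPos"
    and b0: "b 0 = A" "(b has_vector_derivative V) (at 0)"
    and db: "\<And>t. t \<in> J \<Longrightarrow> (b has_vector_derivative b' t) (at t)"
      "\<And>t. t \<in> J \<Longrightarrow> (b' has_vector_derivative b'' t) (at t)"
    and eq: "\<And>t. t \<in> J \<Longrightarrow> b'' t + bw.levi_civita (b t) (b' t) (b' t) = 0"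
    unfolding bw.geodesic_from_def bw.geodesic_def by auto
  have b'Sym: "b' t \<in> Sym" if "t \<in> J" for t
    using Sym_vector_derivative[OF db(1)[OF that] J(1) that] bpos SymPos_Sym by blast
  have b'0: "b' 0 = V" using vector_derivative_unique_at[OF db(1)[OF J(3)] b0(2)] .
  define Z where "Z t = lyap (b t) (b' t)" for t
  have ZSym: "Z t \<in> Sym" if "t \<in> J" for t
    unfolding Z_def by (rule lyap_Sym[OF bpos[OF that] b'Sym[OF that]])
  have Zeq: "b t ** Z t + Z t ** b t = b' t" if "t \<in> J" for t
    unfolding Z_def by (rule lyap_equation[OF bpos[OF that] b'Sym[OF that]])
  have Z0: "Z 0 = S" by (simp add: Z_def b0 b'0 S_def)
  have b2: "b'' t = 2 *\<^sub>R (Z t ** b t ** Z t)" if t: "t \<in> J" for t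
    using eq[OF t]
    unfolding levi_civita_eq_bw_christoffel[OF bpos[OF t] b'Sym[OF t] b'Sym[OF t]]
      bw_christoffel_diag Z_def[symmetric] by simp
  have dZ: "(Z has_vector_derivative - (Z t ** Z t)) (at t)" if t: "t \<in> J" for t
  proof -
    have "(Z has_vector_derivative lyap (b t) (b'' t - (b' t ** Z t + Z t ** b' t))) (at t)"
      unfolding Z_def[abs_def]
      by (rule has_vector_derivative_lyap[OF db(1)[OF t] db(2)[OF t] J(1) t bpos b'Sym])
    moreover have "lyap (b t) (b'' t - (b' t ** Z t + Z t ** b' t)) = - (Z t ** Z t)"
    proof (rule lyap_eqI[OF bpos[OF t]])
      show "- (Z t ** Z t) \<in> Sym"
        using ZSym[OF t] by (simp add: Sym_def transpose_linear_simps)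
      show "b t ** - (Z t ** Z t) + - (Z t ** Z t) ** b t = b'' t - (b' t ** Z t + Z t ** b' t)"
        unfolding b2[OF t] Zeq[OF t, symmetric] by (simp add: matrix_distribs scaleR_2)
    qed
    ultimately show ?thesis by simp
  qed
  have "\<exists>K>0. \<forall>(X :: real^'n^'n) (Y :: real^'n^'n). norm (X ** Y) \<le> norm X * norm Y * K"
    by (rule matrix_mult.pos_bounded)
  then obtain K where K: "\<forall>(X :: real^'n^'n) (Y :: real^'n^'n). norm (X ** Y) \<le> norm X * norm Y * K"
    by blast
  have contZ: "continuous_on J Z"
    using dZ by (intro continuous_at_imp_continuous_on ballI has_vector_derivative_continuous) blast
  let ?P = "\<lambda>t. mat 1 + t *\<^sub>R S"
  have PZ: "?P t ** Z t = S" if t: "t \<in> J" for t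
  proof -
    define D where "D t = ?P t ** Z t - S" for t
    have "D t = 0"
    proof (rule gronwall_zero[OF J(2,3) _ _ _ _ t])
      show "(D has_vector_derivative - (D s ** Z s)) (at s)" if s: "s \<in> J" for s
      proof -
        have "(D has_vector_derivative (?P s ** - (Z s ** Z s) + S ** Z s - 0)) (at s)"
          unfolding D_def[abs_def]
          by (rule has_vector_derivative_diff[OF has_vector_derivative_matrix_mult[OF
                  has_vector_derivative_shift dZ[OF s]] has_vector_derivative_const])
        moreover have "?P s ** - (Z s ** Z s) + S ** Z s - 0 = - (D s ** Z s)"
          by (simp add: D_def matrix_distribs)
        ultimately show ?thesis by simp
      qed
      show "D 0 = 0" by (simp add: D_def Z0)
      show "continuous_on J (\<lambda>s. norm (Z s) * K)" by (intro continuous_intros contZ)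
      show "norm (- (D s ** Z s)) \<le> norm (Z s) * K * norm (D s)" for s
        using K[rule_format, of "D s" "Z s"] by (simp add: mult_ac)
    qed
    then show ?thesis by (simp add: D_def)
  qed
  have ZP: "Z t ** ?P t = S" if t: "t \<in> J" for t
    using arg_cong[OF PZ[OF t], of transpose] SymD[OF ZSym[OF t]] SymD[OF S]
    by (simp add: matrix_transpose_mul transpose_linear_simps)
  show bc: "b t = bw_curve A S t" if t: "t \<in> J" for t
  proof -
    define D where "D t = b t - bw_curve A S t" for t
    have "D t = 0"
    proof (rule gronwall_zero[OF J(2,3) _ _ _ _ t])
      show "(D has_vector_derivative (D s ** Z s + Z s ** D s)) (at s)" if s: "s \<in> J" for s
      proof -
        have "(D has_vector_derivative (b' s - (?P s ** A ** S + S ** A ** ?P s))) (at s)"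
          unfolding D_def[abs_def]
          by (rule has_vector_derivative_diff[OF db(1)[OF s] has_vector_derivative_bw_curve])
        moreover have "?P s ** A ** S = bw_curve A S s ** Z s"
          unfolding bw_curve_def matrix_mul_assoc[symmetric] PZ[OF s] ..
        moreover have "S ** A ** ?P s = Z s ** bw_curve A S s"
          unfolding bw_curve_def matrix_mul_assoc ZP[OF s] ..
        ultimately have "(D has_vector_derivative
            (b' s - (bw_curve A S s ** Z s + Z s ** bw_curve A S s))) (at s)" by simp
        moreover have "b' s - (bw_curve A S s ** Z s + Z s ** bw_curve A S s) = D s ** Z s + Z s ** D s"
          unfolding Zeq[OF s, symmetric] by (simp add: D_def matrix_distribs)
        ultimately show ?thesis by simp
      qed
      show "D 0 = 0" by (simp add: D_def b0)
      show "continuous_on J (\<lambda>s. 2 * (norm (Z s) * K))" by (intro continuous_intros contZ)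
      show "norm (D s ** Z s + Z s ** D s) \<le> 2 * (norm (Z s) * K) * norm (D s)" for s
        using norm_triangle_ineq[of "D s ** Z s" "Z s ** D s"]
          K[rule_format, of "D s" "Z s"] K[rule_format, of "Z s" "D s"] by (simp add: mult_ac)
    qed
    then show ?thesis by (simp add: D_def)
  qed
  show "J \<subseteq> bw_interval S"
  proof
    fix t assume t: "t \<in> J"
    show "t \<in> bw_interval S"
    proof (rule ccontr)
      assume "t \<notin> bw_interval S"
      then have "1 + t * lam_min S \<le> 0 \<or> 1 + t * lam_max S \<le> 0"
        unfolding bw_interval_iff[OF S] by auto
      then obtain l where l: "l \<in> eigenvals S" "1 + t * l \<le> 0"
        using lam_min_Sym(1)[OF S] lam_max_Sym(1)[OF S] by auto
      from l(1) obtain x where x: "x \<noteq> 0" "S *v x = l *\<^sub>R x" by (auto simp: eigenvals_def)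
      \<comment> \<open>the zero of \<open>1 + s * l\<close>, which lies between \<open>0\<close> and \<open>t\<close>\<close>
      define s where "s = - 1 / l"
      have "l \<noteq> 0" using l(2) by auto
      then have s: "1 + s * l = 0" by (simp add: s_def)
      have "s \<in> J"
      proof (cases "0 < l")
        case True
        then have "t \<le> s" "s \<le> 0" using l(2) by (auto simp: s_def field_simps)
        then show ?thesis by (rule mem_is_interval_1_I[OF J(2) t J(3)])
      next
        case False
        with \<open>l \<noteq> 0\<close> have "0 \<le> s" "s \<le> t" using l(2) by (auto simp: s_def field_simps)
        then show ?thesis by (rule mem_is_interval_1_I[OF J(2,3) t])
      qed
      then have "0 < x \<bullet> (bw_curve A S s *v x)"
        using SymPosD[OF bpos x(1)] bc by metis
      moreover have "?P s *v x = 0" by (simp add: eigenvector_shift[OF x(2)] s)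
      ultimately show False
        by (simp add: bw_curve_def flip: matrix_vector_mul_assoc)
    qed
  qed
qed

theorem maximal_geodesic_bw_curve:
  fixes A V :: "real^'n^'n"
  assumes A: "A \<in> SymPos" and V: "V \<in> Sym"
  shows "bw.maximal_geodesic A V (bw_interval (lyap A V)) (bw_curve A (lyap A V))"
proof -
  let ?S = "lyap A V"
  have "(bw_curve A ?S has_vector_derivative V) (at 0)"
    using has_vector_derivative_bw_curve[of A ?S 0] lyap_equation[OF A V] by simp
  then have "bw.geodesic_from A V (bw_interval ?S) (bw_curve A ?S)"
    using geodesic_bw_curve[OF A lyap_Sym[OF A V]]
    by (simp add: bw.geodesic_from_def zero_in_bw_interval)
  moreover have "J \<subseteq> bw_interval ?S \<and> (\<forall>t\<in>J. b t = bw_curve A ?S t)"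
    if "bw.geodesic_from A V J b" for J b
    using geodesic_from_unique[OF A V that] by blast
  ultimately show ?thesis unfolding bw.maximal_geodesic_def by blast
qed

lemma
  fixes A V :: "real^'n^'n"
  assumes A: "A \<in> SymPos" and V: "V \<in> Sym"
  shows def_interval_bw: "bw.def_interval A V = bw_interval (lyap A V)"
    and maximal_geodesic_geod: "bw.maximal_geodesic A V (bw.def_interval A V) (bw.geod A V)"
    and geod_bw: "t \<in> bw_interval (lyap A V) \<Longrightarrow> bw.geod A V t = bw_curve A (lyap A V) t"
proof -
  note max = maximal_geodesic_bw_curve[OF A V]
  show 1: "bw.def_interval A V = bw_interval (lyap A V)"
    unfolding bw.def_interval_def
  proof (rule the_equality)
    show "\<exists>c. bw.maximal_geodesic A V (bw_interval (lyap A V)) c" using max by blast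
    show "I = bw_interval (lyap A V)" if "\<exists>c. bw.maximal_geodesic A V I c" for I
      using that max unfolding bw.maximal_geodesic_def by (meson subset_antisym)
  qed
  show 2: "bw.maximal_geodesic A V (bw.def_interval A V) (bw.geod A V)"
    unfolding bw.geod_def 1 by (rule someI[of _ "bw_curve A (lyap A V)"]) (rule max)
  show "bw.geod A V t = bw_curve A (lyap A V) t" if "t \<in> bw_interval (lyap A V)"
    using 2 max that unfolding 1 bw.maximal_geodesic_def by blast
qed

section \<open>Lengths of curves and the calibration argument\<close>

text \<open>Joint continuity of \<open>lyap\<close>: by coercivity, the deviation from the limit is controlled by the defect
  \<open>G\<close> in the Lyapunov equation.\<close>
lemma tendsto_lyap:
  fixes c v :: "'b \<Rightarrow> real^'n^'n"
  assumes c: "(c \<longlongrightarrow> A) F" and v: "(v \<longlongrightarrow> V) F" and A: "A \<in> SymPos" and V: "V \<in> Sym"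
    and ev: "\<forall>\<^sub>F s in F. c s \<in> SymPos \<and> v s \<in> Sym"
  shows "((\<lambda>s. lyap (c s) (v s)) \<longlongrightarrow> lyap A V) F"
proof -
  define Z where "Z = lyap A V"
  define G where "G s = (v s - V) - ((c s - A) ** Z + Z ** (c s - A))" for s
  have "((\<lambda>s. (v s - V) - ((c s - A) ** Z + Z ** (c s - A))) \<longlongrightarrow>
      (V - V) - ((A - A) ** Z + Z ** (A - A))) F"
    by (intro tendsto_intros matrix_mult.tendsto c v)
  then have G: "(G \<longlongrightarrow> 0) F" by (simp add: G_def[abs_def])
  obtain m where m: "m > 0" "\<forall>\<^sub>F B in nhds A. \<forall>Z. m * norm Z \<le> norm (B ** Z + Z ** B)"
    using lyapunov_norm_lower_near[OF A] by blast
  have "\<forall>\<^sub>F s in F. \<forall>Z. m * norm Z \<le> norm (c s ** Z + Z ** c s)"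
    using m(2) c by (rule eventually_compose_filterlim)
  then have "\<forall>\<^sub>F s in F. norm (lyap (c s) (v s) - Z) \<le> norm (G s) * (1 / m)"
    using ev
  proof eventually_elim
    case (elim s)
    let ?E = "lyap (c s) (v s) - Z"
    have "c s ** ?E + ?E ** c s =
        (c s ** lyap (c s) (v s) + lyap (c s) (v s) ** c s) - (A ** Z + Z ** A)
        - ((c s - A) ** Z + Z ** (c s - A))"
      by (simp add: matrix_distribs)
    also have "\<dots> = G s"
      using elim(2) lyap_equation[OF A V] lyap_equation[of "c s" "v s"] by (simp add: G_def Z_def)
    finally have "m * norm ?E \<le> norm (G s)" using elim(1) by metis
    then show ?case using m(1) by (simp add: field_simps)
  qed
  then have "((\<lambda>s. lyap (c s) (v s) - Z) \<longlongrightarrow> 0) F"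
    by (rule tendsto_0_le[OF G])
  then show ?thesis unfolding Z_def by (rule LIM_zero_cancel)
qed

text \<open>A property that adjacent intervals pass on to their union holds on the whole interval as soon as
  it holds between consecutive break points.\<close>
lemma piecewise_induct:
  fixes P :: "real \<Rightarrow> real \<Rightarrow> bool"
  assumes "finite S" and "a < b"
    and "\<And>x y. a \<le> x \<Longrightarrow> x < y \<Longrightarrow> y \<le> b \<Longrightarrow> {x<..<y} \<inter> S = {} \<Longrightarrow> P x y"
    and "\<And>x y z. x < y \<Longrightarrow> y < z \<Longrightarrow> P x y \<Longrightarrow> P y z \<Longrightarrow> P x z"
  shows "P a b"
  using assms
proof (induction S arbitrary: a b rule: finite_induct)
  case empty
  then show ?case by simp
next
  case (insert s S)
  show ?case
  proof (cases "s \<in> {a<..<b}")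
    case True
    then have s: "a < s" "s < b" by auto
    have "P a s"
    proof (rule insert.IH[OF s(1)])
      fix x y assume "a \<le> x" "x < y" "y \<le> s" "{x<..<y} \<inter> S = {}"
      then show "P x y" using s by (intro insert.prems(2)) auto
    qed (rule insert.prems(3))
    moreover have "P s b"
    proof (rule insert.IH[OF s(2)])
      fix x y assume "s \<le> x" "x < y" "y \<le> b" "{x<..<y} \<inter> S = {}"
      then show "P x y" using s by (intro insert.prems(2)) auto
    qed (rule insert.prems(3))
    ultimately show ?thesis using insert.prems(3)[OF s] by blast
  next
    case False
    show ?thesis
    proof (rule insert.IH[OF insert.prems(1)])
      fix x y assume "a \<le> x" "x < y" "y \<le> b" "{x<..<y} \<inter> S = {}"
      then show "P x y" using False by (intro insert.prems(2)) auto
    qed (rule insert.prems(3))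
  qed
qed

lemma Sym_vector_derivative_within:
  fixes c :: "real \<Rightarrow> real^'n^'n"
  assumes c: "(c has_vector_derivative c') (at t within {x..y})" and xy: "x < y" "t \<in> {x..y}"
    and S: "\<And>s. s \<in> {x..y} \<Longrightarrow> c s \<in> Sym"
  shows "c' \<in> Sym"
proof -
  have "((\<lambda>s. transpose (c s)) has_vector_derivative transpose c') (at t within {x..y})"
    by (rule bounded_linear.has_vector_derivative[OF linear_transpose[unfolded linear_conv_bounded_linear] c])
  then have "(c has_vector_derivative transpose c') (at t within {x..y})"
    by (rule has_vector_derivative_transform[OF xy(2), rotated]) (simp add: S SymD)
  with c have "transpose c' = c'"
    using vector_derivative_unique_within_closed_interval[of x y t c "transpose c'" c'] xy by simp
  then show ?thesis by (simp add: Sym_def)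
qed

lemma piecewise_C1_continuous:
  assumes "piecewise_C1_curve a b c" "a < b"
  shows "continuous_on {a..b} c"
proof -
  obtain S where S: "finite S" "\<And>x y. a \<le> x \<Longrightarrow> x < y \<Longrightarrow> y \<le> b \<Longrightarrow> {x<..<y} \<inter> S = {} \<Longrightarrow>
      \<exists>D. continuous_on {x..y} D \<and> (\<forall>t\<in>{x..y}. (c has_vector_derivative D t) (at t within {x..y}))"
    using assms(1) unfolding piecewise_C1_curve_def by blast
  show ?thesis
  proof (rule piecewise_induct[where P = "\<lambda>x y. continuous_on {x..y} c", OF S(1) assms(2)])
    fix x y assume "a \<le> x" "x < y" "y \<le> b" "{x<..<y} \<inter> S = {}"
    from S(2)[OF this] show "continuous_on {x..y} c"
      by (auto simp: continuous_on_eq_continuous_within intro: has_vector_derivative_continuous)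
  next
    fix x y z :: real assume "x < y" "y < z" "continuous_on {x..y} c" "continuous_on {y..z} c"
    moreover from this have "{x..y} \<union> {y..z} = {x..z}" by auto
    ultimately show "continuous_on {x..z} c"
      using continuous_on_closed_Un[of "{x..y}" "{y..z}" c] by simp
  qed
qed

definition bw_speed :: "(real \<Rightarrow> real^'n^'n) \<Rightarrow> real \<Rightarrow> real" where
  "bw_speed c t = bw.vnorm (c t) (vector_derivative c (at t))"

lemma bw_vnorm_nonneg:
  fixes A V :: "real^'n^'n"
  assumes "A \<in> SymPos" "V \<in> Sym"
  shows "0 \<le> bw.vnorm A V"
  using trace_sandwich_nonneg[OF assms(1) lyap_Sym[OF assms]]
  by (simp add: bw.vnorm_def bw_metric_def)

lemma C1_piece_speed:
  fixes c :: "real \<Rightarrow> real^'n^'n"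
  assumes xy: "x < y" and D: "continuous_on {x..y} D"
    and c: "\<forall>t\<in>{x..y}. (c has_vector_derivative D t) (at t within {x..y})"
    and pos: "\<forall>t\<in>{x..y}. c t \<in> SymPos"
  shows "continuous_on {x..y} (\<lambda>t. bw.vnorm (c t) (D t))"
    and "\<And>t. t \<in> {x<..<y} \<Longrightarrow> (c has_vector_derivative D t) (at t)"
    and "\<And>t. t \<in> {x<..<y} \<Longrightarrow> bw_speed c t = bw.vnorm (c t) (D t)"
    and "\<And>t. t \<in> {x..y} \<Longrightarrow> D t \<in> Sym"
proof -
  show DS: "D t \<in> Sym" if t: "t \<in> {x..y}" for t
    by (rule Sym_vector_derivative_within[OF bspec[OF c t] xy t]) (use pos SymPos_Sym in blast)
  have cc: "continuous_on {x..y} c"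
    unfolding continuous_on_eq_continuous_within using c has_vector_derivative_continuous by blast
  have cl: "continuous_on {x..y} (\<lambda>t. lyap (c t) (D t))"
    unfolding continuous_on_def
  proof
    fix t assume t: "t \<in> {x..y}"
    show "((\<lambda>t. lyap (c t) (D t)) \<longlongrightarrow> lyap (c t) (D t)) (at t within {x..y})"
    proof (rule tendsto_lyap)
      show "(c \<longlongrightarrow> c t) (at t within {x..y})" "(D \<longlongrightarrow> D t) (at t within {x..y})"
        using cc D t by (auto simp: continuous_on_def)
      show "\<forall>\<^sub>F s in at t within {x..y}. c s \<in> SymPos \<and> D s \<in> Sym"
        using pos DS by (auto simp: eventually_at_filter)
    qed (rule bspec[OF pos t] DS[OF t])+
  qed
  have "continuous_on {x..y} (\<lambda>t. trace (lyap (c t) (D t) ** c t ** lyap (c t) (D t)))"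
    by (intro bounded_linear.continuous_on[OF linear_trace[unfolded linear_conv_bounded_linear]]
        matrix_mult.continuous_on cl cc)
  then show "continuous_on {x..y} (\<lambda>t. bw.vnorm (c t) (D t))"
    unfolding bw.vnorm_def bw_metric_def by (intro continuous_intros)
  show d: "(c has_vector_derivative D t) (at t)" if t: "t \<in> {x<..<y}" for t
  proof -
    have "at t within {x..y} = at t" by (rule at_within_interior) (use t in simp)
    then show ?thesis using bspec[OF c, of t] t by simp
  qed
  show "bw_speed c t = bw.vnorm (c t) (D t)" if "t \<in> {x<..<y}" for t
    using vector_derivative_at[OF d[OF that]] by (simp add: bw_speed_def)
qed

text \<open>The speed \<open>l\<close> is set to \<open>0\<close> at break points and end points, where \<open>vector_derivative\<close> is an
  arbitrary value and the square root in \<open>vnorm\<close> need not be nonnegative. A finite set does not change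
  the integral.\<close>
lemma piecewise_C1_speed:
  fixes c :: "real \<Rightarrow> real^'n^'n"
  assumes c: "piecewise_C1_curve 0 1 c" and pos: "c ` {0..1} \<subseteq> SymPos"
  obtains S l where "finite S" "l integrable_on {0..1}" "integral {0..1} l = bw.curve_length c 0 1"
    "\<forall>t. 0 \<le> l t"
    "\<forall>t\<in>{0<..<1} - S. continuous (at t) l"
    "\<forall>t\<in>{0<..<1} - S. \<exists>c'. (c has_vector_derivative c') (at t) \<and> c' \<in> Sym \<and> l t = bw.vnorm (c t) c'"
proof -
  obtain S where S: "finite S" "\<And>x y. 0 \<le> x \<Longrightarrow> x < y \<Longrightarrow> y \<le> 1 \<Longrightarrow> {x<..<y} \<inter> S = {} \<Longrightarrow>
      \<exists>D. continuous_on {x..y} D \<and> (\<forall>t\<in>{x..y}. (c has_vector_derivative D t) (at t within {x..y}))"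
    using c unfolding piecewise_C1_curve_def by blast
  have posc: "c t \<in> SymPos" if "t \<in> {0..1}" for t using pos that by blast
  define l where "l t = (if t \<in> {0<..<1} - S then bw_speed c t else 0)" for t
  have opn: "open ({0<..<1} - S)" using S(1) by (intro open_Diff finite_imp_closed) auto
  have int: "bw_speed c integrable_on {0..1}"
  proof (rule piecewise_induct[where P = "\<lambda>x y. bw_speed c integrable_on {x..y}", OF S(1)])
    fix x y :: real assume xy: "0 \<le> x" "x < y" "y \<le> 1" "{x<..<y} \<inter> S = {}"
    then obtain D where D: "continuous_on {x..y} D"
      "\<forall>t\<in>{x..y}. (c has_vector_derivative D t) (at t within {x..y})"
      using S(2) by blast
    have p: "\<forall>t\<in>{x..y}. c t \<in> SymPos" using posc xy by auto
    note piece = C1_piece_speed[OF xy(2) D p]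
    show "bw_speed c integrable_on {x..y}"
    proof (rule integrable_spike_finite)
      show "finite {x, y}" by simp
      show "(\<lambda>t. bw.vnorm (c t) (D t)) integrable_on {x..y}"
        by (rule integrable_continuous_interval[OF piece(1)])
      show "bw_speed c t = bw.vnorm (c t) (D t)" if "t \<in> {x..y} - {x, y}" for t
        using that by (intro piece(3)) auto
    qed
  next
    fix x y z :: real assume "x < y" "y < z" "bw_speed c integrable_on {x..y}" "bw_speed c integrable_on {y..z}"
    then show "bw_speed c integrable_on {x..z}"
      using Henstock_Kurzweil_Integration.integrable_combine[of x y z "bw_speed c"] by simp
  qed simp
  have off: "l t = bw_speed c t" if "t \<in> {0..1} - (S \<union> {0, 1})" for t
    using that by (auto simp: l_def)
  have fin: "finite (S \<union> {0, 1})" using S(1) by simp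
  have lint: "l integrable_on {0..1}"
    by (rule integrable_spike_finite[OF fin off int])
  have "integral {0..1} l = integral {0..1} (bw_speed c)"
    by (rule integral_spike[OF negligible_finite[OF fin]]) (use off in auto)
  then have leng: "integral {0..1} l = bw.curve_length c 0 1"
    by (simp add: bw.curve_length_def bw_speed_def[abs_def])
  have loc: "(\<exists>c'. (c has_vector_derivative c') (at t) \<and> c' \<in> Sym \<and> l t = bw.vnorm (c t) c') \<and> continuous (at t) l"
    if t: "t \<in> {0<..<1} - S" for t
  proof -
    obtain e where e: "e > 0" "cball t e \<subseteq> {0<..<1} - S"
      using opn t open_contains_cball by metis
    have I: "{t - e..t + e} \<subseteq> {0<..<1} - S" using e(2) by (simp add: cball_eq_atLeastAtMost)
    have end1: "t - e \<in> {t - e..t + e}" and end2: "t + e \<in> {t - e..t + e}" using e(1) by auto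
    have xy: "0 \<le> t - e" "t - e < t + e" "t + e \<le> 1"
      using subsetD[OF I end1] subsetD[OF I end2] e(1) by auto
    have disj: "{t - e<..<t + e} \<inter> S = {}"
      using I greaterThanLessThan_subseteq_atLeastAtMost_iff by fastforce
    from S(2)[OF xy disj] obtain D where D: "continuous_on {t - e..t + e} D"
      "\<forall>s\<in>{t - e..t + e}. (c has_vector_derivative D s) (at s within {t - e..t + e})"
      by blast
    have p: "\<forall>s\<in>{t - e..t + e}. c s \<in> SymPos"
    proof
      show "c s \<in> SymPos" if "s \<in> {t - e..t + e}" for s using subsetD[OF I that] by (intro posc) simp
    qed
    note piece = C1_piece_speed[OF xy(2) D p]
    have tI: "t \<in> {t - e<..<t + e}" "t \<in> {t - e..t + e}" using e(1) by auto
    have le: "l s = bw.vnorm (c s) (D s)" if s: "s \<in> {t - e<..<t + e}" for s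
    proof -
      have "s \<in> {t - e..t + e}" using s by auto
      from subsetD[OF I this] show ?thesis using piece(3)[OF s] by (simp add: l_def)
    qed
    have "continuous_on {t - e<..<t + e} (\<lambda>s. bw.vnorm (c s) (D s))"
      by (rule continuous_on_subset[OF piece(1)]) auto
    then have "continuous_on {t - e<..<t + e} l"
      by (rule continuous_on_eq) (simp add: le)
    then have "continuous (at t) l"
      using tI(1) by (simp add: continuous_on_eq_continuous_at)
    then show ?thesis using piece(2)[OF tI(1)] piece(4)[OF tI(2)] le[OF tI(1)] by blast
  qed
  have nonneg: "0 \<le> l t" for t
  proof (cases "t \<in> {0<..<1} - S")
    case True
    then have "c t \<in> SymPos" by (intro posc) auto
    with loc[OF True] bw_vnorm_nonneg show ?thesis by metis
  next
    case False
    then have "l t = 0" unfolding l_def by (rule if_not_P)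
    then show ?thesis by simp
  qed
  show thesis
    by (rule that[OF S(1) lint leng]) (use loc nonneg in blast)+
qed

lemma curve_length_nonneg:
  fixes c :: "real \<Rightarrow> real^'n^'n"
  assumes "piecewise_C1_curve 0 1 c" "c ` {0..1} \<subseteq> SymPos"
  shows "0 \<le> bw.curve_length c 0 1"
proof -
  obtain N l where N: "finite N" "l integrable_on {0..1}" "integral {0..1} l = bw.curve_length c 0 1"
    "\<forall>t. 0 \<le> l t"
    "\<forall>t\<in>{0<..<1} - N. continuous (at t) l"
    "\<forall>t\<in>{0<..<1} - N. \<exists>c'. (c has_vector_derivative c') (at t) \<and> c' \<in> Sym \<and> l t = bw.vnorm (c t) c'"
    by (rule piecewise_C1_speed[OF assms])
  show ?thesis
    unfolding N(3)[symmetric] by (rule integral_nonneg[OF N(2)]) (use N(4) in blast)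
qed

text \<open>This is \<open>0 \<le> tr (X C X)\<close> for \<open>X = h Z - Y\<close>, divided by \<open>h\<close>. The left-hand side is the derivative of
  \<open>tr (Z c)\<close> when \<open>Z\<close> moves by the Riccati equation at rate \<open>h\<close> and \<open>c\<close> has velocity \<open>C Y + Y C\<close>.\<close>
lemma calibration_pointwise:
  fixes C Y Z :: "real^'n^'n"
  assumes C: "C \<in> SymPos" and Y: "Y \<in> Sym" and Z: "Z \<in> Sym" and h: "h > 0"
  shows "trace (Z ** (C ** Y + Y ** C) - h *\<^sub>R (Z ** Z ** C)) \<le> trace (Y ** C ** Y) / h"
proof -
  note Cs = SymPos_Sym[OF C]
  have "h *\<^sub>R Z - Y \<in> Sym" using Y Z by (intro Sym_intros)
  from trace_sandwich_nonneg[OF C this]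
  have "0 \<le> h * (h * trace (Z ** C ** Z)) - h * trace (Z ** C ** Y) - h * trace (Y ** C ** Z) + trace (Y ** C ** Y)"
    by (simp add: matrix_distribs trace_linear_simps algebra_simps)
  moreover have "trace (Y ** C ** Z) = trace (Z ** C ** Y)" by (rule trace_reverse3[OF Y Cs Z])
  moreover have "trace (Z ** Y ** C) = trace (Z ** C ** Y)"
    using trace_reverse3[OF Z Y Cs] trace_mul_sym[of "C ** Y" Z] by (simp add: matrix_mul_assoc)
  moreover have "trace (Z ** Z ** C) = trace (Z ** C ** Z)"
    using trace_mul_sym[of Z "Z ** C"] by (simp add: matrix_mul_assoc)
  ultimately show ?thesis
    using h by (simp add: matrix_distribs trace_linear_simps field_simps)
qed

text \<open>The calibrating function grows linearly along the geodesic, at the rate of its squared speed.\<close>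
lemma trace_velocity_bw_curve:
  fixes A S :: "real^'n^'n"
  assumes S: "S \<in> Sym" and t: "t \<in> bw_interval S"
  shows "trace (bw_velocity S t ** bw_curve A S t) = trace (S ** A) + t * trace (S ** A ** S)"
proof -
  have "bw_velocity S t ** bw_curve A S t = S ** A ** (mat 1 + t *\<^sub>R S)"
    unfolding bw_curve_def matrix_mul_assoc bw_velocity_right[OF S t] ..
  then show ?thesis by (simp add: matrix_distribs trace_linear_simps)
qed

text \<open>The calibration argument. The parameter \<open>s\<close> of the calibrating matrices \<open>bw_velocity S s\<close> follows
  the arc length of \<open>c\<close>, rescaled to run from \<open>a\<close> to \<open>b\<close>. Adding \<open>e > 0\<close> to the speed keeps
  \<open>s' = h\<close> positive where \<open>c\<close> is at rest; letting \<open>e\<close> tend to \<open>0\<close> gives the inequality.\<close>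
theorem length_lower_bound:
  fixes A S :: "real^'n^'n"
  assumes S: "S \<in> Sym" and ab: "a < b" and I: "{a..b} \<subseteq> bw_interval S"
    and c: "piecewise_C1_curve 0 1 c" "c ` {0..1} \<subseteq> SymPos"
    and ends: "c 0 = bw_curve A S a" "c 1 = bw_curve A S b"
  shows "(b - a)\<^sup>2 * trace (S ** A ** S) \<le> (bw.curve_length c 0 1)\<^sup>2"
proof -
  define L where "L = bw.curve_length c 0 1"
  obtain N l where N: "finite N" "l integrable_on {0..1}" "integral {0..1} l = bw.curve_length c 0 1"
    "\<forall>t. 0 \<le> l t"
    and cont: "\<forall>t\<in>{0<..<1} - N. continuous (at t) l"
    and der: "\<forall>t\<in>{0<..<1} - N. \<exists>c'. (c has_vector_derivative c') (at t) \<and> c' \<in> Sym \<and> l t = bw.vnorm (c t) c'"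
    by (rule piecewise_C1_speed[OF c])
  have L0: "0 \<le> bw.curve_length c 0 1" by (rule curve_length_nonneg[OF c])
  have eps: "(b - a)\<^sup>2 * trace (S ** A ** S) \<le> L * (L + e)" if e: "e > 0" for e
  proof -
    have Le: "L + e > 0" using L0 e by (simp add: L_def)
    \<comment> \<open>normalizes the total variation of \<open>s\<close> to \<open>b - a\<close>\<close>
    define k where "k = (b - a) / (L + e)"
    have k: "k > 0" using ab Le by (simp add: k_def)
    define h where "h t = k * (l t + e)" for t
    have hpos: "h t > 0" for t
      unfolding h_def using k e N(4) by (intro mult_pos_pos add_nonneg_pos) auto
    have hint: "h integrable_on {0..1}"
      unfolding h_def[abs_def]
      using integrable_cmul[OF integrable_add[OF N(2) integrable_const_ivl[of e]], of k] by simp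
    define s where "s t = a + integral {0..t} h" for t
    have "integral {0..1} (\<lambda>t. l t + e) = L + integral {0..1} (\<lambda>t::real. e)"
      unfolding L_def N(3)[symmetric]
      by (rule Henstock_Kurzweil_Integration.integral_add[OF N(2) integrable_const_ivl])
    then have "integral {0..1} h = k * (L + e)"
      unfolding h_def by simp
    then have s1: "s 1 = b" using Le by (simp add: s_def k_def)
    have s0: "s 0 = a" by (simp add: s_def)
    have s_ab: "s t \<in> {a..b}" if t: "t \<in> {0..1}" for t
    proof -
      have hi: "h integrable_on {0..t}" "h integrable_on {t..1}"
        using integrable_on_subinterval[OF hint] t by auto
      have "0 \<le> integral {0..t} h" "0 \<le> integral {t..1} h"
        by (rule integral_nonneg[OF hi(1) less_imp_le[OF hpos]] integral_nonneg[OF hi(2) less_imp_le[OF hpos]])+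
      moreover have "integral {0..t} h + integral {t..1} h = integral {0..1} h"
        using t by (intro Henstock_Kurzweil_Integration.integral_combine hint) auto
      ultimately show ?thesis using s1 by (simp add: s_def)
    qed
    have sI: "s t \<in> bw_interval S" if "t \<in> {0..1}" for t using s_ab[OF that] I by blast
    have scont: "continuous_on {0..1} s"
      unfolding s_def[abs_def] by (intro continuous_intros indefinite_integral_continuous_1 hint)
    have sder: "(s has_vector_derivative h t) (at t)" if t: "t \<in> {0<..<1} - N" for t
    proof -
      have "open ({0<..<1} - N)" using N(1) by (intro open_Diff finite_imp_closed) auto
      then have "t \<in> interior ({0..1} - N)" using t by (intro interiorI[of "{0<..<1} - N"]) auto
      then have at: "at t within ({0..1} - N) = at t" by (rule at_within_interior)
      have "continuous (at t) h"
        unfolding h_def[abs_def] using cont t by (intro continuous_intros) auto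
      then have "((\<lambda>u. integral {0..u} h) has_vector_derivative h t) (at t within ({0..1} - N))"
        using t by (intro integral_has_vector_derivative_continuous_at[OF hint _ N(1)]) (auto simp: at)
      from has_vector_derivative_add[OF has_vector_derivative_const[of a] this]
      show ?thesis unfolding at s_def[abs_def] by simp
    qed
    define Z where "Z t = bw_velocity S (s t)" for t
    define F where "F t = trace (Z t ** c t)" for t
    \<comment> \<open>\<open>0\<close> on the exceptional set, so that the bound by \<open>l / k\<close> holds at every point\<close>
    define F' where "F' t = (if t \<in> {0<..<1} - N
        then trace (Z t ** vector_derivative c (at t) - h t *\<^sub>R (Z t ** Z t ** c t)) else 0)" for t
    have "continuous_on (bw_interval S) (bw_velocity S)"
      using bw_velocity_riccati[OF S]
      by (intro continuous_at_imp_continuous_on ballI has_vector_derivative_continuous) blast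
    then have "continuous_on {0..1} (\<lambda>t. bw_velocity S (s t))"
      by (rule continuous_on_compose2[OF _ scont]) (use sI in blast)
    then have Fcont: "continuous_on {0..1} F"
      unfolding F_def[abs_def] Z_def[abs_def]
      by (intro bounded_linear.continuous_on[OF linear_trace[unfolded linear_conv_bounded_linear]]
          matrix_mult.continuous_on piecewise_C1_continuous[OF c(1)]) simp_all
    have Fder: "(F has_vector_derivative F' t) (at t)" if t: "t \<in> {0<..<1} - N" for t
    proof -
      obtain c' where c': "(c has_vector_derivative c') (at t)" using der t by blast
      have vd: "vector_derivative c (at t) = c'" by (rule vector_derivative_at[OF c'])
      have t01: "t \<in> {0..1}" using t by auto
      have "((bw_velocity S \<circ> s) has_vector_derivative
          h t *\<^sub>R - (bw_velocity S (s t) ** bw_velocity S (s t))) (at t)"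
        by (rule vector_diff_chain_at[OF sder[OF t] bw_velocity_riccati[OF S sI[OF t01]]])
      then have dZ: "(Z has_vector_derivative - (h t *\<^sub>R (Z t ** Z t))) (at t)"
        by (simp add: Z_def[abs_def] o_def)
      have "(F has_vector_derivative trace (Z t ** c' + - (h t *\<^sub>R (Z t ** Z t)) ** c t)) (at t)"
        unfolding F_def[abs_def]
        by (rule has_vector_derivative_trace[OF has_vector_derivative_matrix_mult[OF dZ c']])
      moreover have "Z t ** c' + - (h t *\<^sub>R (Z t ** Z t)) ** c t = Z t ** c' - h t *\<^sub>R (Z t ** Z t ** c t)"
        by (simp add: matrix_mult.minus_left matrix_mult.scaleR_left)
      ultimately show ?thesis using t by (simp add: F'_def vd)
    qed
    have Fle: "F' t \<le> l t * (1 / k)" for t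
    proof (cases "t \<in> {0<..<1} - N")
      case t: True
      obtain c' where c': "(c has_vector_derivative c') (at t)" "c' \<in> Sym" "l t = bw.vnorm (c t) c'"
        using der t by blast
      have t01: "t \<in> {0..1}" using t by auto
      have ct: "c t \<in> SymPos" using c(2) t01 by blast
      define Y where "Y = lyap (c t) c'"
      have Y: "Y \<in> Sym" unfolding Y_def by (rule lyap_Sym[OF ct c'(2)])
      have eq: "c t ** Y + Y ** c t = c'" unfolding Y_def by (rule lyap_equation[OF ct c'(2)])
      have ls: "trace (Y ** c t ** Y) = (l t)\<^sup>2"
        using trace_sandwich_nonneg[OF ct Y] by (simp add: c'(3) bw.vnorm_def bw_metric_def Y_def)
      have "Z t \<in> Sym" unfolding Z_def by (rule bw_velocity_Sym[OF S sI[OF t01]])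
      from calibration_pointwise[OF ct Y this hpos[of t]]
      have "F' t \<le> (l t)\<^sup>2 / h t"
        using t by (simp add: F'_def vector_derivative_at[OF c'(1)] eq ls)
      also have "\<dots> \<le> l t * (1 / k)"
      proof -
        have "0 \<le> l t" using N(4) by blast
        then have "l t / (l t + e) \<le> 1" using e by simp
        then have "(l t / k) * (l t / (l t + e)) \<le> (l t / k) * 1"
          using \<open>0 \<le> l t\<close> k by (intro mult_left_mono) auto
        then show ?thesis by (simp add: h_def power2_eq_square)
      qed
      finally show ?thesis .
    next
      case False
      then have "F' t = 0" unfolding F'_def by (rule if_not_P)
      then show ?thesis using N(4) k by simp
    qed
    have "(F' has_integral (F 1 - F 0)) {0..1}"
      by (rule fundamental_theorem_of_calculus_interior_strong[OF N(1) _ Fder Fcont]) auto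
    moreover have "((\<lambda>t. l t * (1 / k)) has_integral (L * (1 / k))) {0..1}"
      using integrable_integral[OF N(2)] unfolding N(3) L_def by (rule has_integral_mult_left)
    ultimately have "F 1 - F 0 \<le> L * (1 / k)"
      by (rule has_integral_le) (use Fle in blast)
    moreover have "F 1 - F 0 = (b - a) * trace (S ** A ** S)"
    proof -
      have "a \<in> bw_interval S" "b \<in> bw_interval S" using I ab by auto
      then show ?thesis
        by (simp add: F_def Z_def s0 s1 ends trace_velocity_bw_curve[OF S] algebra_simps)
    qed
    ultimately have "(b - a) * trace (S ** A ** S) \<le> L * (L + e) / (b - a)"
      by (simp add: k_def)
    then show ?thesis using ab by (simp add: field_simps power2_eq_square)
  qed
  have "((\<lambda>e. L * (L + e)) \<longlongrightarrow> L * (L + 0)) (at_right 0)"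
    by (intro tendsto_intros)
  then have "(b - a)\<^sup>2 * trace (S ** A ** S) \<le> L * (L + 0)"
    by (rule tendsto_lowerbound)
       (auto intro!: eventually_mono[OF eventually_at_right_less] eps)
  then show "(b - a)\<^sup>2 * trace (S ** A ** S) \<le> (bw.curve_length c 0 1)\<^sup>2"
    by (simp add: L_def power2_eq_square)
qed

section \<open>Distances along geodesics\<close>

lemma lyap_scaleR:
  fixes A V :: "real^'n^'n"
  assumes "A \<in> SymPos" "V \<in> Sym"
  shows "lyap A (k *\<^sub>R V) = k *\<^sub>R lyap A V"
  using lyap_linear_combination[OF assms(1,2) Sym_0, of k 0] by simp

lemma vnorm_scaleR:
  fixes A V :: "real^'n^'n"
  assumes "A \<in> SymPos" "V \<in> Sym"
  shows "bw.vnorm A (k *\<^sub>R V) = \<bar>k\<bar> * bw.vnorm A V"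
  by (simp add: bw.vnorm_def bw_metric_def lyap_scaleR[OF assms] matrix_distribs trace_linear_simps
      real_sqrt_mult flip: mult.assoc)

lemma vnorm_bw_curve_derivative:
  fixes A S :: "real^'n^'n"
  assumes A: "A \<in> SymPos" and S: "S \<in> Sym" and t: "t \<in> bw_interval S"
  shows "bw.vnorm (bw_curve A S t) ((mat 1 + t *\<^sub>R S) ** A ** S + S ** A ** (mat 1 + t *\<^sub>R S)) =
    sqrt (trace (S ** A ** S))"
  by (simp add: bw.vnorm_def bw_metric_def lyap_bw_curve[OF A S t] bw_velocity_sandwich[OF A S t])

text \<open>The infimum is attained by the affinely reparametrized geodesic segment, whose speed is constant
  because \<open>Z c Z = S A S\<close> along it.\<close>
theorem rdist_bw_curve:
  fixes A S :: "real^'n^'n"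
  assumes A: "A \<in> SymPos" and S: "S \<in> Sym"
    and a: "a \<in> bw_interval S" and b: "b \<in> bw_interval S" and ab: "a \<le> b"
  shows "bw.rdist (bw_curve A S a) (bw_curve A S b) = (b - a) * sqrt (trace (S ** A ** S))"
proof -
  let ?q = "trace (S ** A ** S)"
  let ?M = "{bw.curve_length c 0 1 | c. piecewise_C1_curve 0 1 c \<and> c ` {0..1} \<subseteq> SymPos \<and>
      c 0 = bw_curve A S a \<and> c 1 = bw_curve A S b}"
  define r where "r t = a + t * (b - a)" for t
  define d where "d t = (mat 1 + t *\<^sub>R S) ** A ** S + S ** A ** (mat 1 + t *\<^sub>R S)" for t
  define c where "c t = bw_curve A S (r t)" for t
  have ab_I: "{a..b} \<subseteq> bw_interval S"
    using mem_is_interval_1_I[OF is_interval_bw_interval[OF S] a b] by auto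
  have r: "r t \<in> bw_interval S" if t: "t \<in> {0..1}" for t
  proof -
    have "0 \<le> t * (b - a)" using t ab by (intro mult_nonneg_nonneg) auto
    moreover have "t * (b - a) \<le> 1 * (b - a)" using t ab by (intro mult_right_mono) auto
    ultimately have "r t \<in> {a..b}" by (simp add: r_def)
    then show ?thesis using ab_I by blast
  qed
  have dc: "(c has_vector_derivative (b - a) *\<^sub>R d (r t)) (at t)" for t
  proof -
    have "(r has_vector_derivative (b - a)) (at t)"
      unfolding r_def[abs_def] by (auto intro!: derivative_eq_intros)
    from vector_diff_chain_at[OF this has_vector_derivative_bw_curve[of A S "r t"]]
    show ?thesis by (simp add: c_def[abs_def] d_def o_def)
  qed
  have contD: "continuous_on T (\<lambda>t. (b - a) *\<^sub>R d (r t))" for T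
    unfolding d_def r_def by (intro continuous_intros matrix_mult.continuous_on)
  have pw: "piecewise_C1_curve 0 1 c"
    unfolding piecewise_C1_curve_def
    by (intro exI[of _ "{}"] conjI allI impI exI[of _ "\<lambda>t. (b - a) *\<^sub>R d (r t)"] ballI
        finite.emptyI contD has_vector_derivative_at_within[OF dc])
  have "bw.curve_length c 0 1 = integral {0..1} (\<lambda>t::real. (b - a) * sqrt ?q)"
    unfolding bw.curve_length_def
  proof (rule Henstock_Kurzweil_Integration.integral_cong)
    fix t :: real assume t: "t \<in> {0..1}"
    have "bw.vnorm (c t) (vector_derivative c (at t)) = bw.vnorm (c t) ((b - a) *\<^sub>R d (r t))"
      by (simp add: vector_derivative_at[OF dc])
    also have "\<dots> = \<bar>b - a\<bar> * bw.vnorm (c t) (d (r t))"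
      unfolding c_def d_def
      by (rule vnorm_scaleR[OF bw_curve_SymPos[OF A r[OF t]] bw_curve_derivative_Sym[OF A S r[OF t]]])
    also have "\<dots> = (b - a) * sqrt ?q"
      using ab vnorm_bw_curve_derivative[OF A S r[OF t]] by (simp add: c_def d_def)
    finally show "bw.vnorm (c t) (vector_derivative c (at t)) = (b - a) * sqrt ?q" .
  qed
  then have len: "bw.curve_length c 0 1 = (b - a) * sqrt ?q" by simp
  have "c ` {0..1} \<subseteq> SymPos" unfolding c_def using bw_curve_SymPos[OF A] r by blast
  moreover have "c 0 = bw_curve A S a" "c 1 = bw_curve A S b" by (simp_all add: c_def r_def)
  ultimately have mem: "(b - a) * sqrt ?q \<in> ?M" using pw len by force
  have q: "0 \<le> ?q" by (rule trace_sandwich_nonneg[OF A S])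
  have lower: "(b - a) * sqrt ?q \<le> x" if "x \<in> ?M" for x
  proof -
    from that obtain e where e: "x = bw.curve_length e 0 1" "piecewise_C1_curve 0 1 e"
      "e ` {0..1} \<subseteq> SymPos" "e 0 = bw_curve A S a" "e 1 = bw_curve A S b" by blast
    show ?thesis
    proof (cases "a < b")
      case True
      note lb = length_lower_bound[OF S True ab_I e(2,3,4,5)]
      have "((b - a) * sqrt ?q)\<^sup>2 \<le> x\<^sup>2"
        using lb q by (simp add: e(1) power_mult_distrib)
      then show ?thesis using curve_length_nonneg[OF e(2,3)] unfolding e(1)[symmetric] by (rule power2_le_imp_le)
    next
      case False
      then have "a = b" using ab by simp
      moreover have "0 \<le> x" using curve_length_nonneg[OF e(2,3)] e(1) by simp
      ultimately show ?thesis by simp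
    qed
  qed
  show ?thesis
    unfolding bw.rdist_def by (rule cInf_eq_minimum[OF mem lower])
qed

lemma curve_length_geodesic:
  fixes A S :: "real^'n^'n"
  assumes A: "A \<in> SymPos" and S: "S \<in> Sym"
    and a: "a \<in> bw_interval S" and b: "b \<in> bw_interval S" and ab: "a \<le> b"
    and c: "\<And>t. t \<in> bw_interval S \<Longrightarrow> c t = bw_curve A S t"
  shows "bw.curve_length c a b = (b - a) * sqrt (trace (S ** A ** S))"
proof -
  have "bw.curve_length c a b = integral {a..b} (\<lambda>t::real. sqrt (trace (S ** A ** S)))"
    unfolding bw.curve_length_def
  proof (rule Henstock_Kurzweil_Integration.integral_cong)
    fix t assume "t \<in> {a..b}"
    then have t: "t \<in> bw_interval S"
      using mem_is_interval_1_I[OF is_interval_bw_interval[OF S] a b] by auto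
    have "(c has_vector_derivative ((mat 1 + t *\<^sub>R S) ** A ** S + S ** A ** (mat 1 + t *\<^sub>R S))) (at t)"
      by (rule has_vector_derivative_transform_within_open[OF has_vector_derivative_bw_curve
            open_bw_interval[OF S] t c[symmetric]])
    from vector_derivative_at[OF this] show
      "bw.vnorm (c t) (vector_derivative c (at t)) = sqrt (trace (S ** A ** S))"
      by (simp add: c[OF t] vnorm_bw_curve_derivative[OF A S t])
  qed
  then show ?thesis using ab by simp
qed

section \<open>The exponential map, its definition interval and the cut time\<close>

lemma geod_formula:
  fixes A V :: "real^'n^'n"
  assumes A: "A \<in> SymPos" and V: "V \<in> Sym" and t: "t \<in> bw.def_interval A V"
  shows "bw.geod A V t = A + t *\<^sub>R V + t\<^sup>2 *\<^sub>R (lyap A V ** A ** lyap A V)"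
    and "bw.geod A V t \<in> SymPos"
proof -
  have t': "t \<in> bw_interval (lyap A V)" using t by (simp add: def_interval_bw[OF A V])
  show "bw.geod A V t = A + t *\<^sub>R V + t\<^sup>2 *\<^sub>R (lyap A V ** A ** lyap A V)"
    unfolding geod_bw[OF A V t'] bw_curve_expand lyap_equation[OF A V] ..
  show "bw.geod A V t \<in> SymPos"
    unfolding geod_bw[OF A V t'] by (rule bw_curve_SymPos[OF A t'])
qed

lemma lam_min_le_lam_max:
  fixes S :: "real^'n^'n"
  assumes "S \<in> Sym"
  shows "lam_min S \<le> lam_max S"
  unfolding lam_max_def using finite_eigenvals[OF assms] lam_min_Sym(1)[OF assms] by (rule Max_ge)

text \<open>Since \<open>lam_min S \<le> lam_max S\<close>, only the smallest eigenvalue matters to the right of \<open>0\<close>, and only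
  the largest one to the left.\<close>
lemma bw_interval_nonneg_iff:
  fixes S :: "real^'n^'n"
  assumes S: "S \<in> Sym" and t: "0 \<le> t"
  shows "t \<in> bw_interval S \<longleftrightarrow> 0 < 1 + t * lam_min S"
  using mult_left_mono[OF lam_min_le_lam_max[OF S] t] unfolding bw_interval_iff[OF S] by linarith

lemma bw_interval_nonpos_iff:
  fixes S :: "real^'n^'n"
  assumes S: "S \<in> Sym" and t: "t \<le> 0"
  shows "t \<in> bw_interval S \<longleftrightarrow> 0 < 1 + t * lam_max S"
  using mult_left_mono_neg[OF lam_min_le_lam_max[OF S] t] unfolding bw_interval_iff[OF S] by linarith

lemma positive_affine_iff:
  fixes l t :: real
  shows "l < 0 \<Longrightarrow> 0 < 1 + t * l \<longleftrightarrow> t < - 1 / l"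
    and "0 < l \<Longrightarrow> 0 < 1 + t * l \<longleftrightarrow> - 1 / l < t"
  by (auto simp: field_simps)

lemma bw_interval_cases:
  fixes S :: "real^'n^'n"
  assumes S: "S \<in> Sym"
  shows "lam_min S < 0 \<Longrightarrow> 0 < lam_max S \<Longrightarrow> bw_interval S = {- 1 / lam_max S <..< - 1 / lam_min S}"
    and "lam_min S < 0 \<Longrightarrow> lam_max S \<le> 0 \<Longrightarrow> bw_interval S = {..< - 1 / lam_min S}"
    and "0 \<le> lam_min S \<Longrightarrow> 0 < lam_max S \<Longrightarrow> bw_interval S = {- 1 / lam_max S <..}"
    and "lam_min S = 0 \<Longrightarrow> lam_max S = 0 \<Longrightarrow> bw_interval S = UNIV"
proof -
  show "bw_interval S = {- 1 / lam_max S <..< - 1 / lam_min S}" if "lam_min S < 0" "0 < lam_max S"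
    using that by (auto simp: bw_interval_iff[OF S] positive_affine_iff)
  show "bw_interval S = {..< - 1 / lam_min S}" if l: "lam_min S < 0" "lam_max S \<le> 0"
  proof (rule set_eqI)
    fix t
    have p: "0 < - 1 / lam_min S" using l(1) by (simp add: field_simps)
    show "t \<in> bw_interval S \<longleftrightarrow> t \<in> {..< - 1 / lam_min S}"
    proof (cases "0 \<le> t")
      case True
      then show ?thesis using l(1) by (simp add: bw_interval_nonneg_iff[OF S] positive_affine_iff)
    next
      case False
      then have "0 \<le> t * lam_max S" using l(2) by (intro mult_nonpos_nonpos) auto
      then have "t \<in> bw_interval S" using False by (simp add: bw_interval_nonpos_iff[OF S])
      moreover have "t < - 1 / lam_min S" using False p by linarith
      ultimately show ?thesis by simp
    qed
  qed
  show "bw_interval S = {- 1 / lam_max S <..}" if l: "0 \<le> lam_min S" "0 < lam_max S"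
  proof (rule set_eqI)
    fix t
    have p: "- 1 / lam_max S < 0" using l(2) by (simp add: field_simps)
    show "t \<in> bw_interval S \<longleftrightarrow> t \<in> {- 1 / lam_max S <..}"
    proof (cases "t \<le> 0")
      case True
      then show ?thesis using l(2) by (simp add: bw_interval_nonpos_iff[OF S] positive_affine_iff)
    next
      case False
      then have "0 \<le> t * lam_min S" using l(1) by (intro mult_nonneg_nonneg) auto
      then have "t \<in> bw_interval S" using False by (simp add: bw_interval_nonneg_iff[OF S])
      moreover have "- 1 / lam_max S < t" using False p by linarith
      ultimately show ?thesis by simp
    qed
  qed
  show "bw_interval S = UNIV" if "lam_min S = 0" "lam_max S = 0"
    using that by (auto simp: bw_interval_iff[OF S])
qed

text \<open>The quadratic form of \<open>S\<close> vanishes, and polarization at \<open>S y\<close> and \<open>y\<close> gives \<open>|S y|\<^sup>2 = 0\<close>.\<close>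
lemma Sym_eq_0_of_eigenvals:
  fixes S :: "real^'n^'n"
  assumes S: "S \<in> Sym" and l: "lam_min S = 0" "lam_max S = 0"
  shows "S = 0"
proof -
  have q: "x \<bullet> (S *v x) = 0" for x
    using lam_min_Sym(2)[OF S, of x] lam_max_Sym(2)[OF S, of x] by (simp add: l)
  have "S *v y = 0" for y
  proof -
    let ?x = "S *v y"
    have "?x \<bullet> (S *v y) = y \<bullet> (S *v ?x)"
      using Sym_inner[OF S, of ?x y] by (simp add: inner_commute)
    then have "2 * (?x \<bullet> (S *v y)) = 0"
      using q[of "?x + y"] q[of ?x] q[of y]
      by (simp add: matrix_vector_right_distrib inner_add_left inner_add_right)
    then show ?thesis by simp
  qed
  then show ?thesis by (simp add: matrix_eq)
qed

lemma Exp_scaled: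
  fixes A V :: "real^'n^'n"
  assumes A: "A \<in> SymPos" and V: "V \<in> Sym" and t: "t \<in> bw_interval (lyap A V)"
  shows "bw.Exp A (t *\<^sub>R V) = bw_curve A (lyap A V) t"
proof -
  have "1 \<in> bw_interval (lyap A (t *\<^sub>R V))"
    using t by (simp add: lyap_scaleR[OF A V] bw_interval_def)
  from geod_bw[OF A Sym_scaleR[OF V] this] show ?thesis
    by (simp add: bw.Exp_def lyap_scaleR[OF A V] bw_curve_def)
qed

text \<open>By minimality, every \<open>t \<ge> 0\<close> in the definition interval belongs to the set whose supremum is the
  cut time, so that this supremum is the right end of the interval.\<close>
lemma cut_time_bw:
  fixes A V :: "real^'n^'n"
  assumes A: "A \<in> SymPos" and V: "V \<in> Sym"
  shows "bw.cut_time A V =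
    (if lam_min (lyap A V) < 0 then ereal (- 1 / lam_min (lyap A V)) else \<infinity>)"
proof -
  define S where "S = lyap A V"
  have S: "S \<in> Sym" unfolding S_def by (rule lyap_Sym[OF A V])
  define X where "X = {t \<in> bw_interval S. bw.rdist A (bw.Exp A (t *\<^sub>R V)) = t * bw.vnorm A V}"
  have cut: "bw.cut_time A V = Sup (ereal ` X)"
    by (simp add: bw.cut_time_def def_interval_bw[OF A V] X_def S_def)
  have X: "t \<in> X" if t: "0 \<le> t" "0 < 1 + t * lam_min S" for t
  proof -
    have tI: "t \<in> bw_interval S" using t by (simp add: bw_interval_nonneg_iff[OF S])
    have "bw.rdist A (bw.Exp A (t *\<^sub>R V)) = t * bw.vnorm A V"
      using rdist_bw_curve[OF A S zero_in_bw_interval tI t(1)] tI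
      by (simp add: Exp_scaled[OF A V] bw.vnorm_def bw_metric_def S_def)
    with tI show ?thesis by (simp add: X_def)
  qed
  show ?thesis
  proof (cases "lam_min S < 0")
    case neg: True
    let ?m = "- 1 / lam_min S"
    have m: "0 < ?m" using neg by (simp add: field_simps)
    have "Sup (ereal ` X) = ereal ?m"
    proof (rule antisym)
      show "Sup (ereal ` X) \<le> ereal ?m"
      proof (rule Sup_least)
        fix y assume "y \<in> ereal ` X"
        then obtain t where t: "y = ereal t" "t \<in> bw_interval S" by (auto simp: X_def)
        then have "t < ?m" using positive_affine_iff(1)[OF neg] unfolding bw_interval_iff[OF S] by blast
        then show "y \<le> ereal ?m" by (simp add: t(1))
      qed
      have up: "ereal r \<le> Sup (ereal ` X)" if r: "0 \<le> r" "r < ?m" for r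
      proof (rule Sup_upper)
        have "0 < 1 + r * lam_min S" using r(2) positive_affine_iff(1)[OF neg] by blast
        then show "ereal r \<in> ereal ` X" using X r(1) by blast
      qed
      show "ereal ?m \<le> Sup (ereal ` X)"
      proof (rule dense_le)
        fix y assume y: "y < ereal ?m"
        show "y \<le> Sup (ereal ` X)"
        proof (cases "y \<le> 0")
          case True
          also have "0 \<le> Sup (ereal ` X)" using up[of 0] m by (simp add: zero_ereal_def)
          finally show ?thesis .
        next
          case False
          with y obtain r where "y = ereal r" by (cases y) auto
          with False y up[of r] show ?thesis by simp
        qed
      qed
    qed
    with neg show ?thesis by (simp add: cut S_def)
  next
    case False
    have "Sup (ereal ` X) = \<infinity>"
    proof (rule SUP_PInfty)
      fix n :: nat
      have "0 \<le> real n * lam_min S" using False by (intro mult_nonneg_nonneg) auto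
      then have "real n \<in> X" by (intro X) linarith+
      then show "\<exists>i\<in>X. ereal (real n) \<le> ereal i" by blast
    qed
    with False show ?thesis by (simp add: cut S_def)
  qed
qed

lemma minimizing_bw:
  fixes A V :: "real^'n^'n"
  assumes A: "A \<in> SymPos" and V: "V \<in> Sym"
  shows "bw.minimizing (bw.def_interval A V) (bw.geod A V)"
  unfolding bw.minimizing_def def_interval_bw[OF A V]
proof (intro ballI impI)
  let ?S = "lyap A V"
  note S = lyap_Sym[OF A V]
  fix a b assume a: "a \<in> bw_interval ?S" and b: "b \<in> bw_interval ?S" and ab: "a \<le> b"
  show "bw.curve_length (bw.geod A V) a b = bw.rdist (bw.geod A V a) (bw.geod A V b)"
    unfolding geod_bw[OF A V a] geod_bw[OF A V b] rdist_bw_curve[OF A S a b ab]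
    by (rule curve_length_geodesic[OF A S a b ab geod_bw[OF A V]])
qed

section \<open>The logarithm map\<close>

text \<open>The optimal transport map between the centred Gaussian measures with covariance matrices \<open>A\<close> and
  \<open>B\<close>, also known as the geometric mean of the inverse of \<open>A\<close> with \<open>B\<close>.\<close>
definition transport_map :: "real^'n^'n \<Rightarrow> real^'n^'n \<Rightarrow> real^'n^'n" where
  "transport_map A B =
     matrix_inv (msqrt A) ** msqrt (msqrt A ** B ** msqrt A) ** matrix_inv (msqrt A)"

text \<open>With \<open>R\<close> the root of \<open>A\<close>, the equation \<open>T A T = B\<close> says that \<open>R T R\<close> is a root of \<open>R B R\<close>, so
  uniqueness of \<open>T\<close> is uniqueness of positive definite square roots.\<close>
lemma
  fixes A B :: "real^'n^'n"
  assumes A: "A \<in> SymPos" and B: "B \<in> SymPos"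
  shows transport_map_SymPos: "transport_map A B \<in> SymPos"
    and transport_map_sandwich: "transport_map A B ** A ** transport_map A B = B"
    and transport_map_unique: "T \<in> SymPos \<Longrightarrow> T ** A ** T = B \<Longrightarrow> T = transport_map A B"
    and symm_cross_root:
      "2 *\<^sub>R symm (cross_root A B) = A ** transport_map A B + transport_map A B ** A"
proof -
  define R where "R = msqrt A"
  define I where "I = matrix_inv R"
  define Q where "Q = msqrt (R ** B ** R)"
  have R: "R \<in> SymPos" "R ** R = A" using msqrt_SymPos[OF A] by (simp_all add: R_def)
  have I: "I ** R = mat 1" "R ** I = mat 1" "I \<in> Sym"
    using SymPos_matrix_inv[OF R(1)] by (simp_all add: I_def)
  have RBR: "R ** B ** R \<in> SymPos"
    by (rule SymPos_sandwich[OF B SymPos_Sym[OF R(1)] SymPos_ker[OF R(1)]])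
  have Q: "Q \<in> SymPos" "Q ** Q = R ** B ** R" using msqrt_SymPos[OF RBR] by (simp_all add: Q_def)
  have T: "transport_map A B = I ** Q ** I" by (simp add: transport_map_def I_def Q_def R_def)
  have IX: "I ** (R ** X) = X" "R ** (I ** X) = X" for X
    by (simp_all add: matrix_mul_assoc I)
  have "x = 0" if "I *v x = 0" for x
  proof -
    have "R *v (I *v x) = x" by (simp add: matrix_vector_mul_assoc I)
    then show ?thesis using that by simp
  qed
  then show "transport_map A B \<in> SymPos"
    unfolding T by (rule SymPos_sandwich[OF Q(1) I(3)])
  have "I ** Q ** I ** A ** (I ** Q ** I) = I ** (Q ** Q) ** I"
    unfolding R(2)[symmetric] by (simp add: IX flip: matrix_mul_assoc)
  also have "\<dots> = B" unfolding Q(2) using I by (simp add: IX flip: matrix_mul_assoc)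
  finally show "transport_map A B ** A ** transport_map A B = B" unfolding T .
  show "T' = transport_map A B" if T': "T' \<in> SymPos" "T' ** A ** T' = B" for T'
  proof -
    have "R ** T' ** R \<in> SymPos"
      by (rule SymPos_sandwich[OF T'(1) SymPos_Sym[OF R(1)] SymPos_ker[OF R(1)]])
    moreover have "(R ** T' ** R) ** (R ** T' ** R) = R ** B ** R"
      unfolding T'(2)[symmetric] R(2)[symmetric] by (simp add: matrix_mul_assoc)
    ultimately have "Q = R ** T' ** R" unfolding Q_def by (rule msqrt_eqI[OF RBR])
    then show ?thesis unfolding T using I by (simp add: IX flip: matrix_mul_assoc)
  qed
  have C: "cross_root A B = R ** Q ** I" by (simp add: cross_root_def R_def Q_def I_def)
  have "(R ** R) ** (I ** Q ** I) = R ** Q ** I" by (simp add: IX flip: matrix_mul_assoc)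
  then have 1: "R ** Q ** I = A ** transport_map A B" unfolding T R(2) by (rule sym)
  have "transpose (A ** transport_map A B) = transport_map A B ** A"
    using \<open>transport_map A B \<in> SymPos\<close> A by (simp add: matrix_transpose_mul SymPos_Sym SymD)
  then show "2 *\<^sub>R symm (cross_root A B) = A ** transport_map A B + transport_map A B ** A"
    by (simp add: symm_def C 1)
qed

lemma Pre_iff:
  fixes A B V :: "real^'n^'n"
  assumes A: "A \<in> SymPos"
  shows "V \<in> bw.Pre A B \<longleftrightarrow>
    V \<in> Sym \<and> mat 1 + lyap A V \<in> SymPos \<and> (mat 1 + lyap A V) ** A ** (mat 1 + lyap A V) = B"
proof (cases "V \<in> Sym \<and> mat 1 + lyap A V \<in> SymPos")
  case True
  then have 1: "1 \<in> bw_interval (lyap A V)" by (simp add: bw_interval_def)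
  have "bw.Exp A V = (mat 1 + lyap A V) ** A ** (mat 1 + lyap A V)"
    using geod_bw[OF A _ 1] True by (simp add: bw.Exp_def bw_curve_def)
  then show ?thesis using True 1 by (simp add: bw.Pre_def def_interval_bw[OF A])
next
  case False
  then show ?thesis by (auto simp: bw.Pre_def def_interval_bw[OF A] bw_interval_def)
qed

definition bw_log :: "real^'n^'n \<Rightarrow> real^'n^'n \<Rightarrow> real^'n^'n" where
  "bw_log A B = 2 *\<^sub>R symm (cross_root A B) - 2 *\<^sub>R A"

lemma
  fixes A B :: "real^'n^'n"
  assumes A: "A \<in> SymPos" and B: "B \<in> SymPos"
  shows bw_log_Sym: "bw_log A B \<in> Sym"
    and lyap_bw_log: "lyap A (bw_log A B) = transport_map A B - mat 1"
proof -
  let ?T = "transport_map A B"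
  have TS: "?T - mat 1 \<in> Sym" by (intro Sym_diff Sym_mat SymPos_Sym transport_map_SymPos A B)
  have eq: "A ** (?T - mat 1) + (?T - mat 1) ** A = bw_log A B"
    unfolding bw_log_def symm_cross_root[OF A B] by (simp add: matrix_distribs scaleR_2)
  show "bw_log A B \<in> Sym"
    unfolding eq[symmetric] by (rule Sym_anticommutator[OF SymPos_Sym[OF A] TS])
  show "lyap A (bw_log A B) = ?T - mat 1" by (rule lyap_eqI[OF A TS eq])
qed

lemma Pre_bw:
  fixes A B :: "real^'n^'n"
  assumes A: "A \<in> SymPos" and B: "B \<in> SymPos"
  shows "bw.Pre A B = {bw_log A B}"
proof -
  have "bw_log A B \<in> bw.Pre A B"
    using transport_map_SymPos[OF A B] transport_map_sandwich[OF A B] bw_log_Sym[OF A B]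
    by (simp add: Pre_iff[OF A] lyap_bw_log[OF A B])
  moreover have "V = bw_log A B" if "V \<in> bw.Pre A B" for V
  proof -
    have V: "V \<in> Sym" and "mat 1 + lyap A V = transport_map A B"
      using that transport_map_unique[OF A B] unfolding Pre_iff[OF A] by blast+
    then have eq: "lyap A V = lyap A (bw_log A B)"
      by (simp add: lyap_bw_log[OF A B] algebra_simps)
    have "V = A ** lyap A V + lyap A V ** A" by (rule lyap_equation[OF A V, symmetric])
    also have "\<dots> = bw_log A B" unfolding eq by (rule lyap_equation[OF A bw_log_Sym[OF A B]])
    finally show ?thesis .
  qed
  ultimately show ?thesis by blast
qed

lemma Logs_bw:
  fixes A B :: "real^'n^'n"
  assumes A: "A \<in> SymPos" and B: "B \<in> SymPos"
  shows "bw.Logs A B = {bw_log A B}"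
proof -
  let ?S = "lyap A (bw_log A B)"
  note V = bw_log_Sym[OF A B]
  have "bw_log A B \<in> bw.Pre A B" by (simp add: Pre_bw[OF A B])
  then have 1: "1 \<in> bw_interval ?S" "bw_curve A ?S 1 = B"
    unfolding Pre_iff[OF A] by (simp_all add: bw_interval_def bw_curve_def)
  have "bw.rdist A B = bw.vnorm A (bw_log A B)"
    using rdist_bw_curve[OF A lyap_Sym[OF A V] zero_in_bw_interval 1(1)] 1(2)
    by (simp add: bw.vnorm_def bw_metric_def)
  then show ?thesis by (auto simp: bw.Logs_def Pre_bw[OF A B])
qed

lemma joining_geod_bw:
  fixes A B :: "real^'n^'n"
  assumes A: "A \<in> SymPos" and B: "B \<in> SymPos"
    and t: "t \<in> bw.def_interval A (bw.joining_vector A B)"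
  shows "bw.joining_geod A B t =
    (1 - t)\<^sup>2 *\<^sub>R A + t\<^sup>2 *\<^sub>R B + (2 * t * (1 - t)) *\<^sub>R symm (cross_root A B)"
proof -
  let ?T = "transport_map A B" and ?M = "2 *\<^sub>R symm (cross_root A B)"
  have j: "bw.joining_vector A B = bw_log A B"
    by (simp add: bw.joining_vector_def Pre_bw[OF A B])
  have "(?T - mat 1) ** A ** (?T - mat 1) = ?T ** A ** ?T - (A ** ?T + ?T ** A) + A"
    by (simp add: matrix_distribs)
  also have "\<dots> = B - ?M + A"
    unfolding transport_map_sandwich[OF A B] symm_cross_root[OF A B] ..
  finally have sq: "lyap A (bw_log A B) ** A ** lyap A (bw_log A B) = B - ?M + A"
    unfolding lyap_bw_log[OF A B] .
  have "bw.joining_geod A B t = A + t *\<^sub>R bw_log A B + t\<^sup>2 *\<^sub>R (B - ?M + A)"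
    using geod_formula(1)[OF A bw_log_Sym[OF A B] t[unfolded j]]
    unfolding bw.joining_geod_def j sq .
  also have "\<dots> = (1 - t)\<^sup>2 *\<^sub>R A + t\<^sup>2 *\<^sub>R B + (2 * t * (1 - t)) *\<^sub>R symm (cross_root A B)"
    by (simp add: bw_log_def algebra_simps power2_eq_square)
  finally show ?thesis .
qed

theorem theorem4p2:
  fixes \<Sigma> :: "real^'n^'n"
  assumes "\<Sigma> \<in> SymPos"
  shows
    "\<comment> \<open>exponential map\<close>
     (\<forall>V\<in>Sym.
        bw.maximal_geodesic \<Sigma> V (bw.def_interval \<Sigma> V) (bw.geod \<Sigma> V) \<and>
        (\<forall>t\<in>bw.def_interval \<Sigma> V.
           bw.geod \<Sigma> V t = \<Sigma> + t *\<^sub>R V + t\<^sup>2 *\<^sub>R (lyap \<Sigma> V ** \<Sigma> ** lyap \<Sigma> V) \<and>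
           bw.geod \<Sigma> V t \<in> SymPos)) \<and>
     \<comment> \<open>definition interval\<close>
     (\<forall>V\<in>Sym.
        let lmax = lam_max (lyap \<Sigma> V); lmin = lam_min (lyap \<Sigma> V) in
        (lmin < 0 \<and> 0 < lmax \<longrightarrow> bw.def_interval \<Sigma> V = {- 1 / lmax <..< - 1 / lmin}) \<and>
        (lmin < 0 \<and> lmax \<le> 0 \<longrightarrow> bw.def_interval \<Sigma> V = {..< - 1 / lmin}) \<and>
        (lmin \<ge> 0 \<and> lmax > 0 \<longrightarrow> bw.def_interval \<Sigma> V = {- 1 / lmax <..}) \<and>
        (lmin = 0 \<and> lmax = 0 \<longrightarrow> bw.def_interval \<Sigma> V = UNIV \<and> V = 0)) \<and>
     \<comment> \<open>cut time\<close>
     (\<forall>V\<in>Sym.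
        bw.cut_time \<Sigma> V =
          (if lam_min (lyap \<Sigma> V) < 0 then ereal (- 1 / lam_min (lyap \<Sigma> V)) else \<infinity>) \<and>
        bw.minimizing (bw.def_interval \<Sigma> V) (bw.geod \<Sigma> V)) \<and>
     \<comment> \<open>logarithm map\<close>
     (\<forall>\<Lambda>\<in>SymPos.
        (\<exists>!V. V \<in> bw.Pre \<Sigma> \<Lambda>) \<and>
        2 *\<^sub>R symm (cross_root \<Sigma> \<Lambda>) - 2 *\<^sub>R \<Sigma> \<in> bw.Pre \<Sigma> \<Lambda> \<and>
        (\<forall>t\<in>bw.def_interval \<Sigma> (bw.joining_vector \<Sigma> \<Lambda>).
           bw.joining_geod \<Sigma> \<Lambda> t =
             (1 - t)\<^sup>2 *\<^sub>R \<Sigma> + t\<^sup>2 *\<^sub>R \<Lambda> + (2 * t * (1 - t)) *\<^sub>R symm (cross_root \<Sigma> \<Lambda>)) \<and>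
        2 *\<^sub>R symm (cross_root \<Sigma> \<Lambda>) - 2 *\<^sub>R \<Sigma> \<in> bw.Logs \<Sigma> \<Lambda>) \<and>
     bw.log_domain \<Sigma> = SymPos \<and>
     (\<forall>\<Lambda>\<in>SymPos. bw.Log \<Sigma> \<Lambda> = 2 *\<^sub>R symm (cross_root \<Sigma> \<Lambda>) - 2 *\<^sub>R \<Sigma>)"
proof (intro conjI ballI)
  note A = assms
  fix V :: "real^'n^'n" assume V: "V \<in> Sym"
  show "bw.maximal_geodesic \<Sigma> V (bw.def_interval \<Sigma> V) (bw.geod \<Sigma> V)"
    by (rule maximal_geodesic_geod[OF A V])
  show "bw.geod \<Sigma> V t = \<Sigma> + t *\<^sub>R V + t\<^sup>2 *\<^sub>R (lyap \<Sigma> V ** \<Sigma> ** lyap \<Sigma> V)"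
    and "bw.geod \<Sigma> V t \<in> SymPos" if "t \<in> bw.def_interval \<Sigma> V" for t
    by (rule geod_formula[OF A V that])+
  show "bw.cut_time \<Sigma> V =
      (if lam_min (lyap \<Sigma> V) < 0 then ereal (- 1 / lam_min (lyap \<Sigma> V)) else \<infinity>)"
    by (rule cut_time_bw[OF A V])
  show "bw.minimizing (bw.def_interval \<Sigma> V) (bw.geod \<Sigma> V)"
    by (rule minimizing_bw[OF A V])
  have "V = 0" if "lam_min (lyap \<Sigma> V) = 0" "lam_max (lyap \<Sigma> V) = 0"
    using Sym_eq_0_of_eigenvals[OF lyap_Sym[OF A V] that] lyap_equation[OF A V] by simp
  then show "let lmax = lam_max (lyap \<Sigma> V); lmin = lam_min (lyap \<Sigma> V) in
        (lmin < 0 \<and> 0 < lmax \<longrightarrow> bw.def_interval \<Sigma> V = {- 1 / lmax <..< - 1 / lmin}) \<and>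
        (lmin < 0 \<and> lmax \<le> 0 \<longrightarrow> bw.def_interval \<Sigma> V = {..< - 1 / lmin}) \<and>
        (lmin \<ge> 0 \<and> lmax > 0 \<longrightarrow> bw.def_interval \<Sigma> V = {- 1 / lmax <..}) \<and>
        (lmin = 0 \<and> lmax = 0 \<longrightarrow> bw.def_interval \<Sigma> V = UNIV \<and> V = 0)"
    using bw_interval_cases[OF lyap_Sym[OF A V]]
    unfolding Let_def def_interval_bw[OF A V] by blast
next
  note A = assms
  fix \<Lambda> :: "real^'n^'n" assume L: "\<Lambda> \<in> SymPos"
  note log = bw_log_def[of \<Sigma> \<Lambda>, symmetric]
  show "\<exists>!V. V \<in> bw.Pre \<Sigma> \<Lambda>" by (simp add: Pre_bw[OF A L])
  show "2 *\<^sub>R symm (cross_root \<Sigma> \<Lambda>) - 2 *\<^sub>R \<Sigma> \<in> bw.Pre \<Sigma> \<Lambda>"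
    unfolding log by (simp add: Pre_bw[OF A L])
  show "2 *\<^sub>R symm (cross_root \<Sigma> \<Lambda>) - 2 *\<^sub>R \<Sigma> \<in> bw.Logs \<Sigma> \<Lambda>"
    unfolding log by (simp add: Logs_bw[OF A L])
  show "bw.Log \<Sigma> \<Lambda> = 2 *\<^sub>R symm (cross_root \<Sigma> \<Lambda>) - 2 *\<^sub>R \<Sigma>"
    unfolding log by (simp add: bw.Log_def Logs_bw[OF A L])
  show "bw.joining_geod \<Sigma> \<Lambda> t =
      (1 - t)\<^sup>2 *\<^sub>R \<Sigma> + t\<^sup>2 *\<^sub>R \<Lambda> + (2 * t * (1 - t)) *\<^sub>R symm (cross_root \<Sigma> \<Lambda>)"
    if "t \<in> bw.def_interval \<Sigma> (bw.joining_vector \<Sigma> \<Lambda>)" for t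
    by (rule joining_geod_bw[OF A L that])
next
  show "bw.log_domain \<Sigma> = SymPos"
    unfolding bw.log_domain_def using Logs_bw[OF assms] by auto
qed

end
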